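(* Let $(M,g)$ be a compact, homogeneous Riemannian manifold. If $(M,g)$ supports a gradient field $X=\nabla f$ such that $(M,g,X)$ has positive weighted sectional curvature, then $(M,g)$ has positive sectional curvature.
   Context: Manifolds are connected and without boundary. Homogeneous means that the isometry group acts transitively. Let $(M,g)$ be a Riemannian manifold and $X$ a smooth vector field on $M$. For an orthonormal pair $(U,V)$ in $T_pM$, let $\sec(U,V)$ be the sectional curvature of the plane spanned by $U,V$, and set $$\sec_X^V(U)=\sec(U,V)+\tfrac12 (L_Xg)(V,V).$$ If $X=\nabla f$ for a smooth function $f$, set $$\overline{\sec}_f^V(U)=\sec(U,V)+\mathrm{Hess}\, f(V,V)+df(V)^2.$$ Write $\sec_X>0$ (resp. $\overline{\sec}_f>0$) if $\sec_X^V(U)>0$ (resp. $\overline{\sec}_f^V(U)>0$) for every point $p$ and every orthonormal pair $(U,V)$ in $T_pM$. The triple $(M,g,X)$ has positive weighted sectional curvature if either $\sec_X>0$, or $X=\nabla f$ and $\overline{\sec}_f>0$ for some smooth function $f$. *)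

theory Defs
  imports "HOL-Analysis.Analysis"
begin

text \<open>Smooth maps on an open subset of a Euclidean space. In finite dimension, continuity of all
  directional derivatives of order \<open>k\<close> is continuity of the \<open>k\<close>-th derivative.\<close>

primrec Ck_on :: "nat \<Rightarrow> 'e::euclidean_space set \<Rightarrow> ('e \<Rightarrow> 'f::real_normed_vector) \<Rightarrow> bool" where
  "Ck_on 0 S f \<longleftrightarrow> continuous_on S f"
| "Ck_on (Suc k) S f \<longleftrightarrow>
     (\<forall>x\<in>S. f differentiable at x) \<and> (\<forall>v. Ck_on k S (\<lambda>x. frechet_derivative f (at x) v))"

definition smooth_on :: "'e::euclidean_space set \<Rightarrow> ('e \<Rightarrow> 'f::real_normed_vector) \<Rightarrow> bool" where
  "smooth_on S f \<longleftrightarrow> (\<forall>k. Ck_on k S f)"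

definition pd :: "'n::finite \<Rightarrow> (real^'n \<Rightarrow> real) \<Rightarrow> real^'n \<Rightarrow> real" where
  "pd i f x = frechet_derivative f (at x) (axis i 1)"


text \<open>A chart is a pair of its domain and its coordinate map; outside the domain the coordinate
  map is irrelevant. A smooth structure on \<open>M\<close> is given by a smooth atlas, which need not be
  maximal.\<close>

type_synonym ('a, 'n) chart = "'a set \<times> ('a \<Rightarrow> real^'n)"

abbreviation coords :: "('a, 'n::finite) chart \<Rightarrow> (real^'n) set" where
  "coords c \<equiv> snd c ` fst c"

abbreviation param :: "('a, 'n::finite) chart \<Rightarrow> real^'n \<Rightarrow> 'a" where
  "param c \<equiv> inv_into (fst c) (snd c)"

definition is_chart :: "'a topology \<Rightarrow> ('a, 'n::finite) chart \<Rightarrow> bool" where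
  "is_chart M c \<longleftrightarrow> openin M (fst c) \<and> open (coords c) \<and>
     homeomorphic_map (subtopology M (fst c)) (top_of_set (coords c)) (snd c)"

definition smooth_atlas :: "'a topology \<Rightarrow> ('a, 'n::finite) chart set \<Rightarrow> bool" where
  "smooth_atlas M A \<longleftrightarrow> (\<forall>c\<in>A. is_chart M c) \<and> (\<Union>c\<in>A. fst c) = topspace M \<and>
     (\<forall>c\<in>A. \<forall>c'\<in>A. smooth_on (snd c ` (fst c \<inter> fst c')) (snd c' \<circ> param c))"

definition smooth_manifold :: "'a topology \<Rightarrow> ('a, 'n::finite) chart set \<Rightarrow> bool" where
  "smooth_manifold M A \<longleftrightarrow>
     Hausdorff_space M \<and> second_countable M \<and> connected_space M \<and> smooth_atlas M A"

definition charts_at :: "('a, 'n::finite) chart set \<Rightarrow> 'a \<Rightarrow> ('a, 'n) chart set" where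
  "charts_at A p = {c \<in> A. p \<in> fst c}"

text \<open>Pointwise objects below are computed in this chart; all the expressions used are tensorial,
  so that the choice of chart does not affect their values.\<close>

definition chart_at :: "('a, 'n::finite) chart set \<Rightarrow> 'a \<Rightarrow> ('a, 'n) chart" where
  "chart_at A p = (SOME c. c \<in> charts_at A p)"


text \<open>A tangent vector at \<open>p\<close> is the family of its components in all charts around \<open>p\<close>; the
  components are related by the differentials of the transition maps. The family is set to \<open>0\<close>
  at charts not around \<open>p\<close>, so that equal tangent vectors are equal functions.\<close>

type_synonym ('a, 'n) tangent = "('a, 'n) chart \<Rightarrow> real^'n"

definition tangent_space :: "('a, 'n::finite) chart set \<Rightarrow> 'a \<Rightarrow> ('a, 'n) tangent set" where
  "tangent_space A p = {v.
     (\<forall>c. c \<notin> charts_at A p \<longrightarrow> v c = 0) \<and>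
     (\<forall>c\<in>charts_at A p. \<forall>c'\<in>charts_at A p.
        v c' = frechet_derivative (snd c' \<circ> param c) (at (snd c p)) (v c))}"

text \<open>The tangent vector \<open>\<partial>\<^sub>i\<close> at \<open>p\<close> of the chart \<open>c\<close>.\<close>

definition coord_vector ::
  "('a, 'n::finite) chart set \<Rightarrow> ('a, 'n) chart \<Rightarrow> 'n \<Rightarrow> 'a \<Rightarrow> ('a, 'n) tangent" where
  "coord_vector A c i p = (\<lambda>c'. if c' \<in> charts_at A p
     then frechet_derivative (snd c' \<circ> param c) (at (snd c p)) (axis i 1) else 0)"


definition smooth_function ::
  "('a, 'n::finite) chart set \<Rightarrow> ('a \<Rightarrow> real) \<Rightarrow> bool" where
  "smooth_function A f \<longleftrightarrow> (\<forall>c\<in>A. smooth_on (coords c) (f \<circ> param c))"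

definition differential ::
  "('a, 'n::finite) chart set \<Rightarrow> ('a \<Rightarrow> real) \<Rightarrow> 'a \<Rightarrow> ('a, 'n) tangent \<Rightarrow> real" where
  "differential A f p v = (let c = chart_at A p in
     frechet_derivative (f \<circ> param c) (at (snd c p)) (v c))"

definition smooth_vector_field ::
  "'a topology \<Rightarrow> ('a, 'n::finite) chart set \<Rightarrow> ('a \<Rightarrow> ('a, 'n) tangent) \<Rightarrow> bool" where
  "smooth_vector_field M A X \<longleftrightarrow> (\<forall>p\<in>topspace M. X p \<in> tangent_space A p) \<and>
     (\<forall>c\<in>A. smooth_on (coords c) (\<lambda>x. X (param c x) c))"

definition smooth_map ::
  "'a topology \<Rightarrow> ('a, 'n::finite) chart set \<Rightarrow> ('a \<Rightarrow> 'a) \<Rightarrow> bool" where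
  "smooth_map M A F \<longleftrightarrow> continuous_map M M F \<and>
     (\<forall>c\<in>A. \<forall>c'\<in>A. smooth_on (snd c ` (fst c \<inter> F -` fst c')) (snd c' \<circ> F \<circ> param c))"

definition pushforward ::
  "('a, 'n::finite) chart set \<Rightarrow> ('a \<Rightarrow> 'a) \<Rightarrow> 'a \<Rightarrow> ('a, 'n) tangent \<Rightarrow> ('a, 'n) tangent" where
  "pushforward A F p v = (\<lambda>c'. if c' \<in> charts_at A (F p)
     then (let c = chart_at A p in
       frechet_derivative (snd c' \<circ> F \<circ> param c) (at (snd c p)) (v c)) else 0)"


text \<open>The matrix \<open>(g\<^sub>i\<^sub>j)\<close> of the metric in the chart \<open>c\<close>, as a function of the coordinates.\<close>

type_synonym ('a, 'n) metric = "'a \<Rightarrow> ('a, 'n) tangent \<Rightarrow> ('a, 'n) tangent \<Rightarrow> real"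

definition metric_matrix ::
  "('a, 'n::finite) chart set \<Rightarrow> ('a, 'n) metric \<Rightarrow> ('a, 'n) chart \<Rightarrow> real^'n \<Rightarrow> real^'n^'n" where
  "metric_matrix A g c x =
     (\<chi> i j. g (param c x) (coord_vector A c i (param c x)) (coord_vector A c j (param c x)))"

definition riemannian_metric ::
  "'a topology \<Rightarrow> ('a, 'n::finite) chart set \<Rightarrow> ('a, 'n) metric \<Rightarrow> bool" where
  "riemannian_metric M A g \<longleftrightarrow>
     (\<forall>p\<in>topspace M. \<forall>u\<in>tangent_space A p. \<forall>v\<in>tangent_space A p.
        g p u v = g p v u \<and>
        (v \<noteq> (\<lambda>c. 0) \<longrightarrow> g p v v > 0) \<and>
        (\<forall>w\<in>tangent_space A p. \<forall>a b. g p (\<lambda>c. a *\<^sub>R u c + b *\<^sub>R v c) w = a * g p u w + b * g p v w)) \<and>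
     (\<forall>c\<in>A. \<forall>i j. smooth_on (coords c) (\<lambda>x. metric_matrix A g c x $ i $ j))"

definition isometry ::
  "'a topology \<Rightarrow> ('a, 'n::finite) chart set \<Rightarrow> ('a, 'n) metric \<Rightarrow> ('a \<Rightarrow> 'a) \<Rightarrow> bool" where
  "isometry M A g F \<longleftrightarrow> bij_betw F (topspace M) (topspace M) \<and>
     smooth_map M A F \<and> smooth_map M A (inv_into (topspace M) F) \<and>
     (\<forall>p\<in>topspace M. \<forall>u\<in>tangent_space A p. \<forall>v\<in>tangent_space A p.
        g (F p) (pushforward A F p u) (pushforward A F p v) = g p u v)"

definition homogeneous ::
  "'a topology \<Rightarrow> ('a, 'n::finite) chart set \<Rightarrow> ('a, 'n) metric \<Rightarrow> bool" where
  "homogeneous M A g \<longleftrightarrow>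
     (\<forall>p\<in>topspace M. \<forall>q\<in>topspace M. \<exists>F. isometry M A g F \<and> F p = q)"


text \<open>Levi-Civita connection and curvature of a metric \<open>G = (g\<^sub>i\<^sub>j)\<close> on an open subset of
  \<open>\<real>\<^sup>n\<close>: \<open>christoffel G k i j\<close> is the \<open>k\<close>-th component of \<open>\<nabla>\<^bsub>\<partial>i\<^esub> \<partial>\<^sub>j\<close>, and
  \<open>curvature_coeff G l i j k\<close> is the \<open>l\<close>-th component of \<open>R(\<partial>\<^sub>i, \<partial>\<^sub>j) \<partial>\<^sub>k\<close>, where
  \<open>R(X, Y) Z = \<nabla>\<^sub>X \<nabla>\<^sub>Y Z - \<nabla>\<^sub>Y \<nabla>\<^sub>X Z - \<nabla>\<^bsub>[X, Y]\<^esub> Z\<close>.\<close>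

definition christoffel ::
  "(real^'n \<Rightarrow> real^'n^'n) \<Rightarrow> 'n::finite \<Rightarrow> 'n \<Rightarrow> 'n \<Rightarrow> real^'n \<Rightarrow> real" where
  "christoffel G k i j x = (\<Sum>l\<in>UNIV. matrix_inv (G x) $ k $ l *
     (pd i (\<lambda>y. G y $ j $ l) x + pd j (\<lambda>y. G y $ i $ l) x - pd l (\<lambda>y. G y $ i $ j) x)) / 2"

definition curvature_coeff ::
  "(real^'n \<Rightarrow> real^'n^'n) \<Rightarrow> 'n::finite \<Rightarrow> 'n \<Rightarrow> 'n \<Rightarrow> 'n \<Rightarrow> real^'n \<Rightarrow> real" where
  "curvature_coeff G l i j k x =
     pd i (christoffel G l j k) x - pd j (christoffel G l i k) x +
     (\<Sum>m\<in>UNIV. christoffel G l i m x * christoffel G m j k x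
                - christoffel G l j m x * christoffel G m i k x)"

definition curvature_op ::
  "(real^'n \<Rightarrow> real^'n^'n) \<Rightarrow> real^'n \<Rightarrow> real^'n \<Rightarrow> real^'n \<Rightarrow> real^'n \<Rightarrow> real^'n::finite" where
  "curvature_op G x u v w = (\<chi> l. \<Sum>i\<in>UNIV. \<Sum>j\<in>UNIV. \<Sum>k\<in>UNIV.
     curvature_coeff G l i j k x * u $ i * v $ j * w $ k)"

definition sec ::
  "('a, 'n::finite) chart set \<Rightarrow> ('a, 'n) metric \<Rightarrow> 'a \<Rightarrow> ('a, 'n) tangent \<Rightarrow> ('a, 'n) tangent \<Rightarrow> real"
  where
  "sec A g p u v = (let c = chart_at A p; G = metric_matrix A g c; x = snd c p in
     ((G x *v curvature_op G x (u c) (v c) (v c)) \<bullet> u c) / (g p u u * g p v v - (g p u v)\<^sup>2))"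


text \<open>\<open>(\<nabla>\<^sup>2 f)(\<partial>\<^sub>i, \<partial>\<^sub>j) = \<partial>\<^sub>i \<partial>\<^sub>j f - (\<nabla>\<^bsub>\<partial>i\<^esub> \<partial>\<^sub>j) f\<close>\<close>

definition hessian ::
  "('a, 'n::finite) chart set \<Rightarrow> ('a, 'n) metric \<Rightarrow> ('a \<Rightarrow> real) \<Rightarrow> 'a \<Rightarrow>
   ('a, 'n) tangent \<Rightarrow> ('a, 'n) tangent \<Rightarrow> real" where
  "hessian A g f p u v = (let c = chart_at A p; G = metric_matrix A g c; x = snd c p;
       h = f \<circ> param c in
     \<Sum>i\<in>UNIV. \<Sum>j\<in>UNIV. u c $ i * v c $ j *
       (pd i (pd j h) x - (\<Sum>k\<in>UNIV. christoffel G k i j x * pd k h x)))"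

text \<open>\<open>(L\<^sub>X g)(\<partial>\<^sub>i, \<partial>\<^sub>j) = X (g\<^sub>i\<^sub>j) - g([X, \<partial>\<^sub>i], \<partial>\<^sub>j) - g(\<partial>\<^sub>i, [X, \<partial>\<^sub>j])\<close>, where the \<open>k\<close>-th component
  of \<open>[X, \<partial>\<^sub>i]\<close> is \<open>- \<partial>\<^sub>i X\<^sup>k\<close>.\<close>

definition lie_derivative_metric ::
  "('a, 'n::finite) chart set \<Rightarrow> ('a, 'n) metric \<Rightarrow> ('a \<Rightarrow> ('a, 'n) tangent) \<Rightarrow> 'a \<Rightarrow>
   ('a, 'n) tangent \<Rightarrow> ('a, 'n) tangent \<Rightarrow> real" where
  "lie_derivative_metric A g X p u v = (let c = chart_at A p; G = metric_matrix A g c; x = snd c p;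
       Y = (\<lambda>k y. X (param c y) c $ k) in
     \<Sum>i\<in>UNIV. \<Sum>j\<in>UNIV. u c $ i * v c $ j *
       (\<Sum>k\<in>UNIV. Y k x * pd k (\<lambda>y. G y $ i $ j) x
                 + pd i (Y k) x * G x $ k $ j + pd j (Y k) x * G x $ i $ k))"

definition is_gradient ::
  "'a topology \<Rightarrow> ('a, 'n::finite) chart set \<Rightarrow> ('a, 'n) metric \<Rightarrow> ('a \<Rightarrow> ('a, 'n) tangent) \<Rightarrow>
   ('a \<Rightarrow> real) \<Rightarrow> bool" where
  "is_gradient M A g X f \<longleftrightarrow> (\<forall>p\<in>topspace M. X p \<in> tangent_space A p \<and>
     (\<forall>v\<in>tangent_space A p. g p (X p) v = differential A f p v))"

definition orthonormal_pair ::
  "('a, 'n::finite) chart set \<Rightarrow> ('a, 'n) metric \<Rightarrow> 'a \<Rightarrow> ('a, 'n) tangent \<Rightarrow> ('a, 'n) tangent \<Rightarrow> bool"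
  where
  "orthonormal_pair A g p u v \<longleftrightarrow> u \<in> tangent_space A p \<and> v \<in> tangent_space A p \<and>
     g p u u = 1 \<and> g p v v = 1 \<and> g p u v = 0"


text \<open>\<open>sec_weighted A g X p v u\<close> is \<open>sec\<^sub>X\<^sup>v(u)\<close>, and \<open>sec_bar A g f p v u\<close> is its strengthened
  version for \<open>X = \<nabla>f\<close>.\<close>

definition sec_weighted ::
  "('a, 'n::finite) chart set \<Rightarrow> ('a, 'n) metric \<Rightarrow> ('a \<Rightarrow> ('a, 'n) tangent) \<Rightarrow> 'a \<Rightarrow>
   ('a, 'n) tangent \<Rightarrow> ('a, 'n) tangent \<Rightarrow> real" where
  "sec_weighted A g X p v u = sec A g p u v + lie_derivative_metric A g X p v v / 2"

definition sec_bar ::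
  "('a, 'n::finite) chart set \<Rightarrow> ('a, 'n) metric \<Rightarrow> ('a \<Rightarrow> real) \<Rightarrow> 'a \<Rightarrow>
   ('a, 'n) tangent \<Rightarrow> ('a, 'n) tangent \<Rightarrow> real" where
  "sec_bar A g f p v u = sec A g p u v + hessian A g f p v v + (differential A f p v)\<^sup>2"

definition positive_weighted_sec ::
  "'a topology \<Rightarrow> ('a, 'n::finite) chart set \<Rightarrow> ('a, 'n) metric \<Rightarrow> ('a \<Rightarrow> ('a, 'n) tangent) \<Rightarrow> bool"
  where
  "positive_weighted_sec M A g X \<longleftrightarrow>
     (\<forall>p\<in>topspace M. \<forall>u v. orthonormal_pair A g p u v \<longrightarrow> sec_weighted A g X p v u > 0) \<or>
     (\<exists>f. smooth_function A f \<and> is_gradient M A g X f \<and>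
        (\<forall>p\<in>topspace M. \<forall>u v. orthonormal_pair A g p u v \<longrightarrow> sec_bar A g f p v u > 0))"

text \<open>Every plane in a tangent space is spanned by an orthonormal pair.\<close>

definition positive_sec ::
  "'a topology \<Rightarrow> ('a, 'n::finite) chart set \<Rightarrow> ('a, 'n) metric \<Rightarrow> bool" where
  "positive_sec M A g \<longleftrightarrow>
     (\<forall>p\<in>topspace M. \<forall>u v. orthonormal_pair A g p u v \<longrightarrow> sec A g p u v > 0)"

end

theory Submission
  imports Defs
begin

text \<open>A maximum point \<open>q\<close> of the potential \<open>f\<close> exists by compactness. There \<open>df = 0\<close> and
  \<open>Hess f \<le> 0\<close>; since \<open>\<nabla>f\<close> vanishes at \<open>q\<close>, also \<open>L\<^sub>X g = 2 Hess f\<close> at \<open>q\<close>. Either positivity condition thus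
  forces all sectional curvatures at \<open>q\<close> to be positive, and a transitive isometry group carries
  this to every point. As curvature is given by Christoffel symbols, its invariance is derived
  from the transformation law
  \<open>D\<phi> (\<Gamma>(u, v)) = D\<^sup>2\<phi>(u, v) + \<Lambda>(D\<phi> u, D\<phi> v)\<close> of the connection under a local isometry \<open>\<phi>\<close>,
  by differentiating it and antisymmetrising; the terms in \<open>D\<^sup>2\<phi>\<close> and \<open>D\<^sup>3\<phi>\<close> drop out by symmetry.\<close>

subsection \<open>Directional derivatives\<close>

text \<open>\<open>sec\<close> is evaluated in whichever chart \<open>chart_at\<close> picks, at
  \<open>p\<close> and at \<open>F p\<close> alike. Its independence of the chart is never proved
  separately: the isometry is written in exactly these two charts and becomes a map between open
  sets of \<open>real^'n\<close> carrying one metric matrix to the other, so a single transformation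
  law handles the isometry and the choice of coordinates together. The obstacle is index calculus:
  changing variables inside nested sums of Christoffel symbols is unmanageable. The local theory
  therefore treats metric and connection as bilinear maps depending on a point, with directional
  derivatives throughout. A connection is tied to its metric only by the Koszul identity, which
  determines it because the metric is nondegenerate. For the curvature, sums over indices are
  confined to two bridges: \<open>conn_koszul\<close> and the identification of
  \<open>curvature_op\<close> with \<open>riem\<close>.\<close>

abbreviation dd :: "('e::euclidean_space \<Rightarrow> 'f::real_normed_vector) \<Rightarrow> 'e \<Rightarrow> 'e \<Rightarrow> 'f" where
  "dd f x \<equiv> frechet_derivative f (at x)"

lemma smooth_on_differentiable: "smooth_on S f \<Longrightarrow> x \<in> S \<Longrightarrow> f differentiable at x"
  unfolding smooth_on_def by (metis Ck_on.simps(2))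

lemma smooth_on_dd: "smooth_on S f \<Longrightarrow> smooth_on S (\<lambda>x. dd f x v)"
  unfolding smooth_on_def by (metis Ck_on.simps(2))

lemma smooth_on_continuous: "smooth_on S f \<Longrightarrow> continuous_on S f"
  unfolding smooth_on_def by (metis Ck_on.simps(1))

lemma dd_has_derivative: "f differentiable at x \<Longrightarrow> (f has_derivative dd f x) (at x)"
  by (simp add: frechet_derivative_works)

lemma dd_eqI: "(f has_derivative f') (at x) \<Longrightarrow> dd f x = f'"
  using frechet_derivative_at by metis

lemma linear_dd: "f differentiable at x \<Longrightarrow> linear (dd f x)"
  by (rule linear_frechet_derivative)

lemma dd_cong:
  assumes "open S" "x \<in> S" "\<And>y. y \<in> S \<Longrightarrow> f y = h y"
  shows "dd f x = dd h x"
proof -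
  have "(f has_derivative D) (at x) \<longleftrightarrow> (h has_derivative D) (at x)" for D
    using has_derivative_transform_within_open[of f D x UNIV S h]
      has_derivative_transform_within_open[of h D x UNIV S f] assms by auto
  then show ?thesis by (simp add: frechet_derivative_def)
qed

lemma differentiable_cong_open:
  assumes "f differentiable at x" "open S" "x \<in> S" "\<And>y. y \<in> S \<Longrightarrow> f y = h y"
  shows "h differentiable at x"
  using assms has_derivative_transform_within_open[of f _ x UNIV S h]
  by (auto simp: differentiable_def)

lemma dd_compose:
  assumes "h differentiable at x" "f differentiable at (h x)"
  shows "dd (\<lambda>y. f (h y)) x v = dd f (h x) (dd h x v)"
  using frechet_derivative_compose[OF assms] by (simp add: o_def fun_eq_iff)

lemma differentiable_compose_at:
  "h differentiable at x \<Longrightarrow> f differentiable at (h x) \<Longrightarrow> (\<lambda>y. f (h y)) differentiable at x"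
  using differentiable_chain_at[of h x f] by (simp add: o_def)

lemma dd_bounded_linear:
  assumes "bounded_linear L" "f differentiable at x"
  shows "dd (\<lambda>y. L (f y)) x v = L (dd f x v)"
  by (subst dd_eqI[OF bounded_linear.has_derivative[OF assms(1) dd_has_derivative[OF assms(2)]]]) simp

section \<open>Derivatives along lines and the symmetry of second derivatives\<close>

lemma has_real_derivative_along_line:
  fixes f :: "'e::euclidean_space \<Rightarrow> real"
  assumes "f differentiable at (x + s *\<^sub>R u)"
  shows "((\<lambda>s. f (x + s *\<^sub>R u)) has_real_derivative dd f (x + s *\<^sub>R u) u) (at s)"
proof -
  have "((\<lambda>s. x + s *\<^sub>R u) has_vector_derivative u) (at s)"
    by (auto intro!: derivative_eq_intros)
  then have "((\<lambda>s. x + s *\<^sub>R u) has_derivative (\<lambda>h. h *\<^sub>R u)) (at s)"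
    by (simp add: has_vector_derivative_def)
  from has_derivative_compose[OF this dd_has_derivative[OF assms]]
  have "((\<lambda>s. f (x + s *\<^sub>R u)) has_derivative (\<lambda>h. dd f (x + s *\<^sub>R u) (h *\<^sub>R u))) (at s)" .
  moreover have "dd f (x + s *\<^sub>R u) (h *\<^sub>R u) = dd f (x + s *\<^sub>R u) u * h" for h
    using linear_cmul[OF linear_dd[OF assms]] by simp
  ultimately show ?thesis by (simp add: has_field_derivative_def)
qed

text \<open>The second difference is symmetric in \<open>u\<close> and \<open>v\<close>, while the
  right-hand side singles out one order of differentiation. Reading it in both orders compares the
  two mixed derivatives.\<close>

lemma second_difference_mvt:
  fixes f :: "'e::euclidean_space \<Rightarrow> real"
  assumes f: "smooth_on S f" and sub: "cball x r \<subseteq> S"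
    and t: "t > 0" "t * (norm u + norm v) \<le> r"
  obtains y where "y \<in> cball x r"
    "f (x + t *\<^sub>R u + t *\<^sub>R v) - f (x + t *\<^sub>R u) - f (x + t *\<^sub>R v) + f x
      = t * t * dd (\<lambda>y. dd f y u) y v"
proof -
  \<comment> \<open>The bound on \<open>t\<close> keeps the whole parallelogram inside the ball, so
    both uses of the mean value theorem stay in \<open>S\<close>.\<close>
  have mem: "x + s *\<^sub>R u + s' *\<^sub>R v \<in> cball x r" if "0 \<le> s" "s \<le> t" "0 \<le> s'" "s' \<le> t" for s s'
  proof -
    have "norm (s *\<^sub>R u + s' *\<^sub>R v) \<le> s * norm u + s' * norm v"
      using norm_triangle_ineq[of "s *\<^sub>R u" "s' *\<^sub>R v"] that by simp
    also have "\<dots> \<le> t * norm u + t * norm v"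
      using that by (intro add_mono mult_right_mono) auto
    finally show ?thesis using t by (simp add: dist_norm algebra_simps norm_minus_commute)
  qed
  \<comment> \<open>The second difference is the increment of \<open>h\<close> from 0 to
    \<open>t\<close>; one mean value step turns it into \<open>t\<close> times an increment of
    \<open>k\<close>, taken along \<open>v\<close>.\<close>
  define h where "h s = f ((x + t *\<^sub>R v) + s *\<^sub>R u) - f (x + s *\<^sub>R u)" for s
  have h': "(h has_real_derivative dd f ((x + t *\<^sub>R v) + s *\<^sub>R u) u - dd f (x + s *\<^sub>R u) u) (at s)"
    if "0 \<le> s" "s \<le> t" for s
    unfolding h_def
    using that mem[of s t] mem[of s 0] t sub
    by (intro DERIV_diff has_real_derivative_along_line smooth_on_differentiable[OF f])
      (auto simp: add_ac)
  obtain s where s: "0 < s" "s < t"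
    and hs: "h t - h 0 = (t - 0) * (dd f ((x + t *\<^sub>R v) + s *\<^sub>R u) u - dd f (x + s *\<^sub>R u) u)"
    using MVT2[OF t(1) h'] by blast
  define k where "k s' = dd f ((x + s *\<^sub>R u) + s' *\<^sub>R v) u" for s'
  have k': "(k has_real_derivative dd (\<lambda>y. dd f y u) ((x + s *\<^sub>R u) + s' *\<^sub>R v) v) (at s')"
    if "0 \<le> s'" "s' \<le> t" for s'
    unfolding k_def using that mem[of s s'] s sub
    by (intro has_real_derivative_along_line smooth_on_differentiable[OF smooth_on_dd[OF f]]) auto
  obtain s' where s': "0 < s'" "s' < t"
    and ks: "k t - k 0 = (t - 0) * dd (\<lambda>y. dd f y u) ((x + s *\<^sub>R u) + s' *\<^sub>R v) v"
    using MVT2[OF t(1) k'] by blast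
  show thesis
  proof (rule that)
    show "x + s *\<^sub>R u + s' *\<^sub>R v \<in> cball x r" using mem[of s s'] s s' by simp
    show "f (x + t *\<^sub>R u + t *\<^sub>R v) - f (x + t *\<^sub>R u) - f (x + t *\<^sub>R v) + f x
      = t * t * dd (\<lambda>y. dd f y u) (x + s *\<^sub>R u + s' *\<^sub>R v) v"
      using hs ks by (simp add: h_def k_def add_ac algebra_simps)
  qed
qed

text \<open>In a small ball, continuity keeps each mixed derivative within half the gap of its value
  at \<open>x\<close>, so the two could not share a value. Yet the same second difference equals
  \<open>t * t\<close> times either of them, taken at suitable points of that ball.\<close>

lemma second_derivative_symmetric_real:
  fixes f :: "'e::euclidean_space \<Rightarrow> real"
  assumes S: "open S" and f: "smooth_on S f" and x: "x \<in> S"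
  shows "dd (\<lambda>y. dd f y u) x v = dd (\<lambda>y. dd f y v) x u"
proof (rule ccontr)
  define a where "a y = dd (\<lambda>y. dd f y u) y v" for y
  define b where "b y = dd (\<lambda>y. dd f y v) y u" for y
  assume "\<not> ?thesis"
  then have e: "\<bar>a x - b x\<bar> / 2 > 0" by (simp add: a_def b_def)
  have "continuous_on S a" "continuous_on S b"
    unfolding a_def b_def by (intro smooth_on_continuous smooth_on_dd f)+
  then have "isCont a x" "isCont b x" using S x by (auto simp: continuous_on_eq_continuous_at)
  then obtain d1 d2 where d1: "d1 > 0" "\<And>y. dist y x < d1 \<Longrightarrow> dist (a y) (a x) < \<bar>a x - b x\<bar> / 2"
    and d2: "d2 > 0" "\<And>y. dist y x < d2 \<Longrightarrow> dist (b y) (b x) < \<bar>a x - b x\<bar> / 2"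
    using e unfolding continuous_at_eps_delta by metis
  obtain d3 where d3: "d3 > 0" "cball x d3 \<subseteq> S" using S x open_contains_cball by metis
  \<comment> \<open>Halving puts the closed ball of radius \<open>r\<close> strictly within the
    radii \<open>d1\<close> and \<open>d2\<close>.\<close>
  define r where "r = min d3 (min d1 d2 / 2)"
  have r: "r > 0" "cball x r \<subseteq> S" "r < d1" "r < d2" using d1 d2 d3 by (auto simp: r_def)
  \<comment> \<open>The added 1 keeps the denominator positive when \<open>u\<close> and
    \<open>v\<close> both vanish.\<close>
  define t where "t = r / (norm u + norm v + 1)"
  have pos: "norm u + norm v + 1 > 0" by (simp add: add_nonneg_pos)
  have t: "t > 0" using r pos by (simp add: t_def)
  have t': "t * (norm u + norm v) \<le> r"
    using r pos t by (simp add: t_def field_simps)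
  obtain y where y: "y \<in> cball x r" "f (x + t *\<^sub>R u + t *\<^sub>R v) - f (x + t *\<^sub>R u) - f (x + t *\<^sub>R v) + f x
      = t * t * a y"
    using second_difference_mvt[OF f r(2) t t'] unfolding a_def by blast
  have t'': "t * (norm v + norm u) \<le> r" using t' by (simp add: add.commute)
  obtain z where z: "z \<in> cball x r" "f (x + t *\<^sub>R v + t *\<^sub>R u) - f (x + t *\<^sub>R v) - f (x + t *\<^sub>R u) + f x
      = t * t * b z"
    using second_difference_mvt[OF f r(2) t t''] unfolding b_def by blast
  have "t * t * a y = t * t * b z" using y z by (simp add: add_ac algebra_simps)
  then have "a y = b z" using t by simp
  moreover have "\<bar>a y - a x\<bar> < \<bar>a x - b x\<bar> / 2" "\<bar>b z - b x\<bar> < \<bar>a x - b x\<bar> / 2"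
    using d1(2)[of y] d2(2)[of z] y(1) z(1) r by (auto simp: dist_commute dist_real_def abs_minus_commute)
  ultimately show False by (smt (verit) field_sum_of_halves)
qed

lemma Ck_on_cong:
  assumes S: "open S" and "\<And>x. x \<in> S \<Longrightarrow> f x = h x"
  shows "Ck_on k S f = Ck_on k S h"
  using assms(2)
proof (induction k arbitrary: f h)
  case 0
  then show ?case by (simp cong: continuous_on_cong)
next
  case (Suc k)
  have "dd f x = dd h x" if "x \<in> S" for x using dd_cong[OF S that] Suc.prems by blast
  moreover have "f differentiable at x \<longleftrightarrow> h differentiable at x" if "x \<in> S" for x
    using differentiable_cong_open[OF _ S that] Suc.prems by metis
  ultimately show ?case
    using Suc.IH[of "\<lambda>x. dd f x v" "\<lambda>x. dd h x v" for v] by auto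
qed

lemma smooth_on_inner:
  assumes "open S" "smooth_on S f"
  shows "smooth_on S (\<lambda>x. f x \<bullet> b)"
proof -
  \<comment> \<open>The induction runs over all smooth functions at once, because its step replaces
    \<open>f\<close> by a directional derivative of \<open>f\<close>.\<close>
  have "\<forall>f. smooth_on S f \<longrightarrow> Ck_on k S (\<lambda>x. f x \<bullet> b)" for k
  proof (induction k)
    case 0
    then show ?case by (simp add: smooth_on_continuous continuous_on_inner)
  next
    case (Suc k)
    show ?case
    proof (intro allI impI)
      fix f :: "'a \<Rightarrow> 'b" assume f: "smooth_on S f"
      have *: "dd (\<lambda>y. f y \<bullet> b) x v = dd f x v \<bullet> b" if "x \<in> S" for x v
        using dd_bounded_linear[OF bounded_linear_inner_left smooth_on_differentiable[OF f that]] .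
      have "(\<lambda>y. f y \<bullet> b) differentiable at x" if "x \<in> S" for x
        using smooth_on_differentiable[OF f that] by simp
      moreover have "Ck_on k S (\<lambda>x. dd (\<lambda>y. f y \<bullet> b) x v)" for v
        using Suc smooth_on_dd[OF f, of v] by (subst Ck_on_cong[OF assms(1) *]) auto
      ultimately show "Ck_on (Suc k) S (\<lambda>x. f x \<bullet> b)" by simp
    qed
  qed
  then show ?thesis using assms(2) by (simp add: smooth_on_def)
qed

lemma second_derivative_symmetric:
  fixes f :: "'e::euclidean_space \<Rightarrow> 'f::euclidean_space"
  assumes S: "open S" and f: "smooth_on S f" and x: "x \<in> S"
  shows "dd (\<lambda>y. dd f y u) x v = dd (\<lambda>y. dd f y v) x u"
proof (rule euclidean_eqI)
  fix b :: 'f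
  have D: "dd (\<lambda>y. f y \<bullet> b) y w = dd f y w \<bullet> b" if "y \<in> S" for y w
    using dd_bounded_linear[OF bounded_linear_inner_left smooth_on_differentiable[OF f that]] .
  have D2: "dd (\<lambda>y. dd (\<lambda>y. f y \<bullet> b) y w) x w' = dd (\<lambda>y. dd f y w) x w' \<bullet> b" for w w'
    using dd_cong[OF S x, of "\<lambda>y. dd (\<lambda>y. f y \<bullet> b) y w" "\<lambda>y. dd f y w \<bullet> b"] D
      dd_bounded_linear[OF bounded_linear_inner_left smooth_on_differentiable[OF smooth_on_dd[OF f] x]]
    by simp
  show "dd (\<lambda>y. dd f y u) x v \<bullet> b = dd (\<lambda>y. dd f y v) x u \<bullet> b"
    using second_derivative_symmetric_real[OF S smooth_on_inner[OF S f] x] D2 by metis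
qed

subsection \<open>Connections under local isometries\<close>

text \<open>A product rule for \<open>L\<close> differentiable only at each fixed argument. Finite
  dimension makes this enough: expanding \<open>a y\<close> in \<open>Basis\<close> leaves finitely
  many scalar coefficients times functions of that kind.\<close>

lemma has_derivative_linear_family:
  fixes L :: "'e::euclidean_space \<Rightarrow> 'a::euclidean_space \<Rightarrow> 'f::real_normed_vector"
  assumes L: "\<And>y. linear (L y)" and dL: "\<And>a. (\<lambda>y. L y a) differentiable at x"
    and a: "(a has_derivative a') (at x)"
  shows "((\<lambda>y. L y (a y)) has_derivative (\<lambda>u. dd (\<lambda>y. L y (a x)) x u + L x (a' u))) (at x)"
proof -
  have rep: "L y c = (\<Sum>b\<in>Basis. (c \<bullet> b) *\<^sub>R L y b)" for y c
  proof -
    have "L y c = L y (\<Sum>b\<in>Basis. (c \<bullet> b) *\<^sub>R b)" by (simp add: euclidean_representation)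
    then show ?thesis by (simp add: linear_sum[OF L] linear_cmul[OF L])
  qed
  have *: "((\<lambda>y. \<Sum>b\<in>Basis. (a y \<bullet> b) *\<^sub>R L y b) has_derivative
     (\<lambda>u. \<Sum>b\<in>Basis. (a x \<bullet> b) *\<^sub>R dd (\<lambda>y. L y b) x u + (a' u \<bullet> b) *\<^sub>R L x b)) (at x)"
    by (intro has_derivative_sum has_derivative_scaleR has_derivative_inner_left a dd_has_derivative dL)
  have "((\<lambda>y. \<Sum>b\<in>Basis. (a x \<bullet> b) *\<^sub>R L y b) has_derivative
     (\<lambda>u. \<Sum>b\<in>Basis. (a x \<bullet> b) *\<^sub>R dd (\<lambda>y. L y b) x u)) (at x)"
    by (intro has_derivative_sum has_derivative_scaleR_right dd_has_derivative dL)
  then have "dd (\<lambda>y. L y (a x)) x u = (\<Sum>b\<in>Basis. (a x \<bullet> b) *\<^sub>R dd (\<lambda>y. L y b) x u)" for u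
    by (simp add: rep[symmetric] dd_eqI)
  then show ?thesis using * by (simp add: rep[symmetric] sum.distrib)
qed

lemma has_derivative_bilinear_family:
  fixes \<Gamma> :: "'e::euclidean_space \<Rightarrow> 'a::euclidean_space \<Rightarrow> 'b::euclidean_space \<Rightarrow> 'f::real_normed_vector"
  assumes \<Gamma>: "\<And>y. bilinear (\<Gamma> y)" and d: "\<And>a b. (\<lambda>y. \<Gamma> y a b) differentiable at x"
    and a: "(a has_derivative a') (at x)" and b: "(b has_derivative b') (at x)"
  shows "((\<lambda>y. \<Gamma> y (a y) (b y)) has_derivative
    (\<lambda>u. dd (\<lambda>y. \<Gamma> y (a x) (b x)) x u + \<Gamma> x (a' u) (b x) + \<Gamma> x (a x) (b' u))) (at x)"
proof -
  have l1: "linear (\<lambda>a. \<Gamma> y a b)" and l2: "linear (\<Gamma> y a)" for y a b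
    using \<Gamma> by (auto simp: bilinear_def)
  have *: "((\<lambda>y. \<Gamma> y (a y) c) has_derivative (\<lambda>u. dd (\<lambda>y. \<Gamma> y (a x) c) x u + \<Gamma> x (a' u) c)) (at x)" for c
    by (rule has_derivative_linear_family[OF l1 d a])
  then have "(\<lambda>y. \<Gamma> y (a y) c) differentiable at x" for c by (auto simp: differentiable_def)
  from has_derivative_linear_family[where L = "\<lambda>y. \<Gamma> y (a y)", OF l2 this b]
  show ?thesis by (simp add: dd_eqI[OF *])
qed

text \<open>With \<open>\<Gamma> x u v\<close> read as the covariant derivative of the constant
  field \<open>v\<close> along \<open>u\<close>, this is the curvature R(u, v) w; the brackets of
  constant fields vanish.\<close>

definition riem ::
  "('e::euclidean_space \<Rightarrow> 'e \<Rightarrow> 'e \<Rightarrow> 'e) \<Rightarrow> 'e \<Rightarrow> 'e \<Rightarrow> 'e \<Rightarrow> 'e \<Rightarrow> 'e" where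
  "riem \<Gamma> x u v w = dd (\<lambda>y. \<Gamma> y v w) x u - dd (\<lambda>y. \<Gamma> y u w) x v
     + \<Gamma> x u (\<Gamma> x v w) - \<Gamma> x v (\<Gamma> x u w)"

text \<open>The Koszul formula evaluated on constant vector fields, so that no Lie brackets occur.\<close>

definition koszul ::
  "('e::euclidean_space \<Rightarrow> 'e \<Rightarrow> 'e \<Rightarrow> real) \<Rightarrow> ('e \<Rightarrow> 'e \<Rightarrow> 'e \<Rightarrow> 'e) \<Rightarrow> 'e \<Rightarrow> bool" where
  "koszul B \<Gamma> x \<longleftrightarrow> (\<forall>u v w. 2 * B x (\<Gamma> x u v) w =
     dd (\<lambda>y. B y v w) x u + dd (\<lambda>y. B y u w) x v - dd (\<lambda>y. B y u v) x w)"

text \<open>The map \<open>\<phi>\<close> is an isometry read in two charts, \<open>B\<close> and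
  \<open>C\<close> are the metrics there, and \<open>\<Gamma>\<close> and \<open>\<Lambda>\<close>
  their Levi-Civita connections, described by the Koszul identity instead of a formula. Bilinearity
  of \<open>C\<close> and \<open>\<Lambda>\<close> is asked at every point because the product rule
  for bilinear families asks for it.\<close>

locale local_isometry =
  fixes S T :: "'e::euclidean_space set" and \<phi> :: "'e \<Rightarrow> 'e"
    and B C :: "'e \<Rightarrow> 'e \<Rightarrow> 'e \<Rightarrow> real" and \<Gamma> \<Lambda> :: "'e \<Rightarrow> 'e \<Rightarrow> 'e \<Rightarrow> 'e"
  assumes open_S: "open S"
    and smooth_\<phi>: "smooth_on S \<phi>" and \<phi>_in: "x \<in> S \<Longrightarrow> \<phi> x \<in> T"
    and bilinear_C: "bilinear (C z)" and symmetric_C: "z \<in> T \<Longrightarrow> C z a b = C z b a"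
    and differentiable_C: "z \<in> T \<Longrightarrow> (\<lambda>z. C z a b) differentiable at z"
    and nondegenerate_C: "z \<in> T \<Longrightarrow> (\<And>b. C z a b = 0) \<Longrightarrow> a = 0"
    and isometric: "x \<in> S \<Longrightarrow> B x a b = C (\<phi> x) (dd \<phi> x a) (dd \<phi> x b)"
    and surj_\<phi>: "x \<in> S \<Longrightarrow> surj (dd \<phi> x)"
    and bilinear_\<Lambda>: "bilinear (\<Lambda> z)"
    and differentiable_\<Gamma>: "x \<in> S \<Longrightarrow> (\<lambda>x. \<Gamma> x a b) differentiable at x"
    and differentiable_\<Lambda>: "z \<in> T \<Longrightarrow> (\<lambda>z. \<Lambda> z a b) differentiable at z"
    and koszul_\<Gamma>: "x \<in> S \<Longrightarrow> koszul B \<Gamma> x" and koszul_\<Lambda>: "z \<in> T \<Longrightarrow> koszul C \<Lambda> z"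
begin

abbreviation dd2 :: "'e \<Rightarrow> 'e \<Rightarrow> 'e \<Rightarrow> 'e" where
  "dd2 x u v \<equiv> dd (\<lambda>y. dd \<phi> y v) x u"

lemma differentiable_\<phi>: "x \<in> S \<Longrightarrow> \<phi> differentiable at x"
  by (rule smooth_on_differentiable[OF smooth_\<phi>])

lemma differentiable_dd_\<phi>: "x \<in> S \<Longrightarrow> (\<lambda>y. dd \<phi> y v) differentiable at x"
  by (rule smooth_on_differentiable[OF smooth_on_dd[OF smooth_\<phi>]])

lemma dd2_sym: "x \<in> S \<Longrightarrow> dd2 x u v = dd2 x v u"
  by (rule second_derivative_symmetric[OF open_S smooth_\<phi>])

text \<open>Differentiating \<open>isometric\<close> gives one term from the moving base point and
  two from the moving differentials.\<close>

lemma dd_B: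
  assumes x: "x \<in> S"
  shows "dd (\<lambda>y. B y v w) x u = dd (\<lambda>z. C z (dd \<phi> x v) (dd \<phi> x w)) (\<phi> x) (dd \<phi> x u)
    + C (\<phi> x) (dd2 x u v) (dd \<phi> x w) + C (\<phi> x) (dd \<phi> x v) (dd2 x u w)"
proof -
  have "dd (\<lambda>y. B y v w) x = dd (\<lambda>y. C (\<phi> y) (dd \<phi> y v) (dd \<phi> y w)) x"
    by (rule dd_cong[OF open_S x]) (rule isometric)
  also have "\<dots> = (\<lambda>u. dd (\<lambda>y. C (\<phi> y) (dd \<phi> x v) (dd \<phi> x w)) x u
     + C (\<phi> x) (dd2 x u v) (dd \<phi> x w) + C (\<phi> x) (dd \<phi> x v) (dd2 x u w))"
    by (intro dd_eqI has_derivative_bilinear_family bilinear_C dd_has_derivative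
        differentiable_compose_at[OF differentiable_\<phi> differentiable_C] differentiable_dd_\<phi> \<phi>_in x)
  finally have "dd (\<lambda>y. B y v w) x u = dd (\<lambda>y. C (\<phi> y) (dd \<phi> x v) (dd \<phi> x w)) x u
     + C (\<phi> x) (dd2 x u v) (dd \<phi> x w) + C (\<phi> x) (dd \<phi> x v) (dd2 x u w)" by simp
  also have "dd (\<lambda>y. C (\<phi> y) (dd \<phi> x v) (dd \<phi> x w)) x u =
      dd (\<lambda>z. C z (dd \<phi> x v) (dd \<phi> x w)) (\<phi> x) (dd \<phi> x u)"
    by (intro dd_compose differentiable_C differentiable_\<phi> \<phi>_in x)
  finally show ?thesis .
qed

text \<open>In the Koszul combination of the three derivatives of \<open>B\<close>, six
  second-derivative terms of \<open>\<phi>\<close> occur. By symmetry four cancel and two coincide,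
  leaving twice the pairing of \<open>dd2 x u v\<close> with the test vector; nondegeneracy then
  removes the test vector.\<close>

lemma connection_transform:
  assumes x: "x \<in> S"
  shows "dd \<phi> x (\<Gamma> x u v) = dd2 x u v + \<Lambda> (\<phi> x) (dd \<phi> x u) (dd \<phi> x v)"
proof -
  have "C (\<phi> x) (dd \<phi> x (\<Gamma> x u v) - (dd2 x u v + \<Lambda> (\<phi> x) (dd \<phi> x u) (dd \<phi> x v))) w' = 0" for w'
  proof -
    \<comment> \<open>The Koszul identity for \<open>\<Gamma>\<close> only sees vectors before
      applying the differential; surjectivity makes every test vector an image of one.\<close>
    obtain w where w: "w' = dd \<phi> x w" using surj_\<phi>[OF x] by auto
    have 1: "2 * C (\<phi> x) (\<Lambda> (\<phi> x) (dd \<phi> x u) (dd \<phi> x v)) w' =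
        dd (\<lambda>z. C z (dd \<phi> x v) w') (\<phi> x) (dd \<phi> x u) + dd (\<lambda>z. C z (dd \<phi> x u) w') (\<phi> x) (dd \<phi> x v)
        - dd (\<lambda>z. C z (dd \<phi> x u) (dd \<phi> x v)) (\<phi> x) w'"
      using koszul_\<Lambda>[OF \<phi>_in[OF x]] by (simp add: koszul_def)
    have "2 * B x (\<Gamma> x u v) w =
        dd (\<lambda>y. B y v w) x u + dd (\<lambda>y. B y u w) x v - dd (\<lambda>y. B y u v) x w"
      using koszul_\<Gamma>[OF x] by (simp add: koszul_def)
    then have "2 * C (\<phi> x) (dd \<phi> x (\<Gamma> x u v)) w' =
        2 * C (\<phi> x) (\<Lambda> (\<phi> x) (dd \<phi> x u) (dd \<phi> x v)) w' + 2 * C (\<phi> x) (dd2 x u v) w'"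
      unfolding 1[unfolded w] w isometric[OF x] dd_B[OF x]
      using dd2_sym[OF x, of u v] dd2_sym[OF x, of u w] dd2_sym[OF x, of v w]
        symmetric_C[OF \<phi>_in[OF x], of "dd \<phi> x v"] symmetric_C[OF \<phi>_in[OF x], of "dd \<phi> x u"]
      by simp
    then show ?thesis
      by (simp add: bilinear_lsub[OF bilinear_C] bilinear_ladd[OF bilinear_C])
  qed
  from nondegenerate_C[OF \<phi>_in[OF x] this] show ?thesis by simp
qed

text \<open>The last bracket and the third
  derivative of \<open>\<phi>\<close> are symmetric in \<open>u\<close> and \<open>v\<close>, hence cancel in the curvature.\<close>

lemma connection_transform_derivative:
  assumes x: "x \<in> S"
  shows "dd \<phi> x (dd (\<lambda>y. \<Gamma> y v w) x u + \<Gamma> x u (\<Gamma> x v w)) =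
    dd (\<lambda>y. dd2 y v w) x u
    + dd (\<lambda>z. \<Lambda> z (dd \<phi> x v) (dd \<phi> x w)) (\<phi> x) (dd \<phi> x u)
    + \<Lambda> (\<phi> x) (dd \<phi> x u) (\<Lambda> (\<phi> x) (dd \<phi> x v) (dd \<phi> x w))
    + (\<Lambda> (\<phi> x) (dd2 x u v) (dd \<phi> x w) + \<Lambda> (\<phi> x) (dd \<phi> x v) (dd2 x u w)
    + \<Lambda> (\<phi> x) (dd \<phi> x u) (dd2 x v w))"
proof -
  note lin = linear_dd[OF differentiable_\<phi>[OF x]]
  \<comment> \<open>\<open>dd \<phi> y\<close> need not be linear for \<open>y\<close> outside \<open>S\<close>.\<close>
  define P where "P y = (if y \<in> S then dd \<phi> y else (\<lambda>_. 0))" for y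
  have P: "linear (P y)" for y
    by (simp add: P_def linear_dd differentiable_\<phi> linear_iff)
       (simp add: linear_dd differentiable_\<phi> linear_add linear_cmul)
  have dP: "(\<lambda>y. P y a) differentiable at x" for a
    by (rule differentiable_cong_open[OF differentiable_dd_\<phi>[OF x, of a] open_S x]) (simp add: P_def)
  have ddP: "dd (\<lambda>y. P y a) x = dd (\<lambda>y. dd \<phi> y a) x" for a
    by (rule dd_cong[OF open_S x]) (simp add: P_def)
  have "((\<lambda>y. P y (\<Gamma> y v w)) has_derivative
      (\<lambda>u. dd (\<lambda>y. P y (\<Gamma> x v w)) x u + P x (dd (\<lambda>y. \<Gamma> y v w) x u))) (at x)"
    by (intro has_derivative_linear_family P dP dd_has_derivative differentiable_\<Gamma> x)
  then have "dd (\<lambda>y. P y (\<Gamma> y v w)) x u = dd2 x u (\<Gamma> x v w) + dd \<phi> x (dd (\<lambda>y. \<Gamma> y v w) x u)"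
    using x by (simp add: dd_eqI ddP) (simp add: P_def)
  moreover have "dd (\<lambda>y. P y (\<Gamma> y v w)) x =
      dd (\<lambda>y. dd2 y v w + \<Lambda> (\<phi> y) (dd \<phi> y v) (dd \<phi> y w)) x"
    by (rule dd_cong[OF open_S x]) (simp add: P_def connection_transform)
  moreover have "((\<lambda>y. dd2 y v w + \<Lambda> (\<phi> y) (dd \<phi> y v) (dd \<phi> y w)) has_derivative
     (\<lambda>u. dd (\<lambda>y. dd2 y v w) x u + (dd (\<lambda>y. \<Lambda> (\<phi> y) (dd \<phi> x v) (dd \<phi> x w)) x u
     + \<Lambda> (\<phi> x) (dd2 x u v) (dd \<phi> x w) + \<Lambda> (\<phi> x) (dd \<phi> x v) (dd2 x u w)))) (at x)"
    by (intro has_derivative_add has_derivative_bilinear_family bilinear_\<Lambda> dd_has_derivative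
        differentiable_compose_at[OF differentiable_\<phi> differentiable_\<Lambda>] differentiable_dd_\<phi> \<phi>_in x
        smooth_on_differentiable[OF smooth_on_dd[OF smooth_on_dd[OF smooth_\<phi>]]])
  moreover have "dd (\<lambda>y. \<Lambda> (\<phi> y) (dd \<phi> x v) (dd \<phi> x w)) x u =
      dd (\<lambda>z. \<Lambda> z (dd \<phi> x v) (dd \<phi> x w)) (\<phi> x) (dd \<phi> x u)"
    by (intro dd_compose differentiable_\<Lambda> differentiable_\<phi> \<phi>_in x)
  ultimately have 1: "dd2 x u (\<Gamma> x v w) + dd \<phi> x (dd (\<lambda>y. \<Gamma> y v w) x u) =
     dd (\<lambda>y. dd2 y v w) x u + (dd (\<lambda>z. \<Lambda> z (dd \<phi> x v) (dd \<phi> x w)) (\<phi> x) (dd \<phi> x u)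
     + \<Lambda> (\<phi> x) (dd2 x u v) (dd \<phi> x w) + \<Lambda> (\<phi> x) (dd \<phi> x v) (dd2 x u w))"
    by (simp add: dd_eqI)
  \<comment> \<open>The transformation law is used twice, for the outer and the inner connection.
    Its term \<open>dd2 x u (\<Gamma> x v w)\<close> also stands on the left of fact
    \<open>1\<close>, so it cancels.\<close>
  have "dd \<phi> x (\<Gamma> x u (\<Gamma> x v w)) = dd2 x u (\<Gamma> x v w)
      + \<Lambda> (\<phi> x) (dd \<phi> x u) (\<Lambda> (\<phi> x) (dd \<phi> x v) (dd \<phi> x w))
      + \<Lambda> (\<phi> x) (dd \<phi> x u) (dd2 x v w)"
    by (simp add: connection_transform[OF x] bilinear_radd[OF bilinear_\<Lambda>])
  with 1 show ?thesis
    by (simp add: linear_add[OF lin] algebra_simps)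
qed

lemma riem_transform:
  assumes x: "x \<in> S"
  shows "dd \<phi> x (riem \<Gamma> x u v w) = riem \<Lambda> (\<phi> x) (dd \<phi> x u) (dd \<phi> x v) (dd \<phi> x w)"
proof -
  have "riem \<Gamma> x u v w = (dd (\<lambda>y. \<Gamma> y v w) x u + \<Gamma> x u (\<Gamma> x v w))
      - (dd (\<lambda>y. \<Gamma> y u w) x v + \<Gamma> x v (\<Gamma> x u w))"
    by (simp add: riem_def)
  \<comment> \<open>The third derivative is the second derivative of \<open>dd \<phi> y w\<close> as
    a function of \<open>y\<close>, hence symmetric in the other two directions.\<close>
  moreover have "dd (\<lambda>y. dd2 y v w) x u = dd (\<lambda>y. dd2 y u w) x v"
    by (rule second_derivative_symmetric[OF open_S smooth_on_dd[OF smooth_\<phi>] x])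
  ultimately show ?thesis
    using dd2_sym[OF x, of u v]
    by (simp add: linear_diff[OF linear_dd[OF differentiable_\<phi>[OF x]]]
        connection_transform_derivative[OF x]) (simp add: riem_def)
qed

end

subsection \<open>Metrics in coordinates\<close>

lemma differentiable_cart:
  fixes f :: "'e::euclidean_space \<Rightarrow> real^'n"
  assumes "\<And>k. (\<lambda>x. f x $ k) differentiable at x"
  shows "f differentiable at x"
  unfolding differentiable_componentwise_within[of f]
  using assms by (auto simp: Basis_vec_def inner_axis)

lemma dd_nth:
  fixes f :: "'e::euclidean_space \<Rightarrow> real^'n"
  shows "f differentiable at x \<Longrightarrow> dd (\<lambda>y. f y $ k) x v = dd f x v $ k"
  by (rule dd_bounded_linear[OF bounded_linear_vec_nth])

lemma linear_axis_expansion: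
  fixes L :: "real^'n \<Rightarrow> 'f::real_vector"
  assumes "linear L"
  shows "L v = (\<Sum>i\<in>UNIV. v $ i *\<^sub>R L (axis i 1))"
proof -
  have "L v = L (\<Sum>i\<in>UNIV. v $ i *\<^sub>R axis i 1)"
    using basis_expansion[of v] by (simp add: scalar_mult_eq_scaleR)
  then show ?thesis by (simp add: linear_sum[OF assms] linear_cmul[OF assms])
qed

lemma dd_eq_sum_pd:
  fixes f :: "real^'n::finite \<Rightarrow> real"
  shows "f differentiable at x \<Longrightarrow> dd f x v = (\<Sum>i\<in>UNIV. v $ i * pd i f x)"
  using linear_axis_expansion[OF linear_dd, of f x v] by (simp add: pd_def)

lemma inner_matrix_vector:
  fixes G :: "real^'n^'m"
  shows "v \<bullet> (G *v w) = (\<Sum>i\<in>UNIV. \<Sum>j\<in>UNIV. v $ i * G $ i $ j * w $ j)"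
  by (simp add: inner_vec_def matrix_vector_mult_def sum_distrib_left mult.assoc)

lemma matrix_inv_mult:
  fixes G :: "real^'n^'n"
  assumes "invertible G"
  shows "G ** matrix_inv G = mat 1" "matrix_inv G ** G = mat 1"
proof -
  have "\<exists>H. G ** H = mat 1 \<and> H ** G = mat 1" using assms by (simp add: invertible_def)
  from someI_ex[OF this] show "G ** matrix_inv G = mat 1" "matrix_inv G ** G = mat 1"
    by (simp_all add: matrix_inv_def)
qed

text \<open>As quotients of determinants, the entries of the inverse visibly depend differentiably
  on those of the matrix; this is how differentiability reaches the Christoffel symbols.\<close>

lemma matrix_inv_cramer:
  fixes G :: "real^'n^'n"
  assumes "invertible G"
  shows "matrix_inv G $ k $ l = det (\<chi> i j. if j = k then axis l 1 $ i else G $ i $ j) / det G"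
proof -
  have "G *v (matrix_inv G *v axis l 1) = axis l 1"
    by (simp add: matrix_vector_mul_assoc matrix_inv_mult[OF assms])
  then have "matrix_inv G *v axis l 1 =
      (\<chi> k. det (\<chi> i j. if j = k then axis l 1 $ i else G $ i $ j) / det G)"
    using cramer[of G] assms by (simp add: invertible_det_nz)
  moreover have "(matrix_inv G *v axis l 1) $ k = matrix_inv G $ k $ l"
    by (simp add: matrix_vector_mul_component inner_axis)
  ultimately show ?thesis by simp
qed

lemma differentiable_prod:
  fixes f :: "'i \<Rightarrow> 'a::real_normed_vector \<Rightarrow> real"
  shows "(\<And>i. i \<in> I \<Longrightarrow> f i differentiable at x) \<Longrightarrow> (\<lambda>x. \<Prod>i\<in>I. f i x) differentiable at x"
  by (induct I rule: infinite_finite_induct) auto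

lemma differentiable_det:
  fixes G :: "'a::real_normed_vector \<Rightarrow> real^'n^'n"
  assumes "\<And>i j. (\<lambda>x. G x $ i $ j) differentiable at x"
  shows "(\<lambda>x. det (G x)) differentiable at x"
  unfolding det_def
  by (intro differentiable_sum differentiable_mult differentiable_prod assms differentiable_const ballI)
     (simp_all add: finite_permutations)

definition smooth_metric :: "(real^'n) set \<Rightarrow> (real^'n \<Rightarrow> real^'n^'n::finite) \<Rightarrow> bool" where
  "smooth_metric S G \<longleftrightarrow> open S \<and> (\<forall>i j. smooth_on S (\<lambda>x. G x $ i $ j)) \<and>
     (\<forall>x\<in>S. (\<forall>i j. G x $ i $ j = G x $ j $ i) \<and> (\<forall>v. v \<noteq> 0 \<longrightarrow> v \<bullet> (G x *v v) > 0))"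

text \<open>The Christoffel symbols bundled into a bilinear map, the form in which
  \<open>local_isometry\<close> expects a connection.\<close>

definition conn :: "(real^'n \<Rightarrow> real^'n^'n::finite) \<Rightarrow> real^'n \<Rightarrow> real^'n \<Rightarrow> real^'n \<Rightarrow> real^'n" where
  "conn G x u v = (\<chi> k. \<Sum>i\<in>UNIV. \<Sum>j\<in>UNIV. christoffel G k i j x * u $ i * v $ j)"

lemma bilinear_conn: "bilinear (conn G x)"
  unfolding bilinear_def linear_iff conn_def
  by (simp add: vec_eq_iff algebra_simps sum.distrib sum_distrib_left)

lemma bilinear_inner_matrix:
  fixes A :: "real^'n^'m"
  shows "bilinear (\<lambda>u v. u \<bullet> (A *v v))"
  unfolding bilinear_def linear_iff
  by (simp add: inner_left_distrib inner_right_distrib matrix_vector_right_distrib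
      linear_cmul[OF matrix_vector_mul_linear])

context
  fixes S :: "(real^'n::finite) set" and G :: "real^'n \<Rightarrow> real^'n^'n"
  assumes G: "smooth_metric S G"
begin

lemma metric_open: "open S" using G by (simp add: smooth_metric_def)

lemma metric_sym: "x \<in> S \<Longrightarrow> G x $ i $ j = G x $ j $ i" using G by (simp add: smooth_metric_def)

lemma metric_sym_inner: "x \<in> S \<Longrightarrow> u \<bullet> (G x *v v) = v \<bullet> (G x *v u)"
  unfolding inner_matrix_vector
  by (subst sum.swap) (intro sum.cong refl, simp add: metric_sym)

lemma metric_pos: "x \<in> S \<Longrightarrow> v \<noteq> 0 \<Longrightarrow> v \<bullet> (G x *v v) > 0" using G by (simp add: smooth_metric_def)

lemma metric_invertible:
  assumes "x \<in> S" shows "invertible (G x)"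
proof -
  have "v = 0" if "G x *v v = 0" for v using metric_pos[OF assms, of v] that by force
  then show ?thesis
    using matrix_left_invertible_ker invertible_left_inverse by blast
qed

lemma metric_smooth: "smooth_on S (\<lambda>x. G x $ i $ j)" using G by (simp add: smooth_metric_def)

lemma metric_diff: "x \<in> S \<Longrightarrow> (\<lambda>x. G x $ i $ j) differentiable at x"
  by (rule smooth_on_differentiable[OF metric_smooth])

lemma pd_diff: "x \<in> S \<Longrightarrow> pd k (\<lambda>y. G y $ i $ j) differentiable at x"
  unfolding pd_def[abs_def] by (rule smooth_on_differentiable[OF smooth_on_dd[OF metric_smooth]])

lemma matrix_inv_diff:
  assumes "x \<in> S" shows "(\<lambda>x. matrix_inv (G x) $ k $ l) differentiable at x"
proof -
  have "(\<lambda>x. (if j = k then axis l 1 $ i else G x $ i $ j) :: real) differentiable at x" for i j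
    using metric_diff[OF assms] by (cases "j = k") simp_all
  then have num: "(\<lambda>x. det (\<chi> i j. if j = k then axis l 1 $ i else G x $ i $ j)) differentiable at x"
    by (intro differentiable_det) simp
  have den: "(\<lambda>x. det (G x)) differentiable at x" by (intro differentiable_det metric_diff assms)
  have "det (G x) \<noteq> 0" using metric_invertible[OF assms] by (simp add: invertible_det_nz)
  note differentiable_divide[OF num den this]
  \<comment> \<open>Cramer's formula is available only where the matrix is invertible, so the two
    functions are compared on the open set \<open>S\<close> alone.\<close>
  then show ?thesis
    by (rule differentiable_cong_open[OF _ metric_open assms])
       (simp add: matrix_inv_cramer[OF metric_invertible])
qed

lemma christoffel_diff: "x \<in> S \<Longrightarrow> christoffel G k i j differentiable at x"
  unfolding christoffel_def[abs_def]
  by (intro differentiable_divide differentiable_sum differentiable_mult differentiable_add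
      differentiable_diff matrix_inv_diff pd_diff differentiable_const ballI) auto

lemma conn_diff: "x \<in> S \<Longrightarrow> (\<lambda>x. conn G x u v) differentiable at x"
  by (rule differentiable_cart)
     (simp add: conn_def christoffel_diff)

lemma inner_metric_diff: "x \<in> S \<Longrightarrow> (\<lambda>y. u \<bullet> (G y *v v)) differentiable at x"
  unfolding inner_matrix_vector by (simp add: metric_diff)

lemma dd_metric:
  assumes x: "x \<in> S"
  shows "dd (\<lambda>y. v \<bullet> (G y *v w)) x u =
    (\<Sum>k\<in>UNIV. \<Sum>i\<in>UNIV. \<Sum>j\<in>UNIV. u $ k * v $ i * w $ j * pd k (\<lambda>y. G y $ i $ j) x)"
proof -
  have "((\<lambda>y. \<Sum>i\<in>UNIV. \<Sum>j\<in>UNIV. v $ i * G y $ i $ j * w $ j) has_derivative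
    (\<lambda>u. \<Sum>i\<in>UNIV. \<Sum>j\<in>UNIV. v $ i * dd (\<lambda>y. G y $ i $ j) x u * w $ j)) (at x)"
    by (intro has_derivative_sum has_derivative_mult_left has_derivative_mult_right
        dd_has_derivative metric_diff x)
  then have "dd (\<lambda>y. v \<bullet> (G y *v w)) x (axis k 1) =
     (\<Sum>i\<in>UNIV. \<Sum>j\<in>UNIV. v $ i * w $ j * pd k (\<lambda>y. G y $ i $ j) x)" for k
    by (simp add: inner_matrix_vector dd_eqI pd_def mult_ac)
  then show ?thesis
    using linear_axis_expansion[OF linear_dd[OF inner_metric_diff[OF x]], of v w u]
    by (simp add: sum_distrib_left mult_ac)
qed

text \<open>The Christoffel formula is the Koszul identity solved for the connection by the inverse
  matrix, so multiplying by \<open>G x\<close> recovers it. The rest reorders sums.\<close>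

lemma conn_koszul:
  assumes x: "x \<in> S"
  shows "koszul (\<lambda>x u v. u \<bullet> (G x *v v)) (conn G) x"
  unfolding koszul_def
proof (intro allI)
  fix u v w :: "real^'n"
  \<comment> \<open>The right-hand side of the Koszul identity as a covector: its pairing with
    \<open>w\<close> is the combination of three derivatives.\<close>
  define c where "c = (\<chi> l. \<Sum>i\<in>UNIV. \<Sum>j\<in>UNIV. (pd i (\<lambda>y. G y $ j $ l) x
      + pd j (\<lambda>y. G y $ i $ l) x - pd l (\<lambda>y. G y $ i $ j) x) * u $ i * v $ j)"
  have "2 *\<^sub>R conn G x u v = matrix_inv (G x) *v c"
  proof (intro vec_eq_iff[THEN iffD2] allI)
    fix k
    have chr: "2 * christoffel G k i j x = (\<Sum>l\<in>UNIV. matrix_inv (G x) $ k $ l *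
       (pd i (\<lambda>y. G y $ j $ l) x + pd j (\<lambda>y. G y $ i $ l) x - pd l (\<lambda>y. G y $ i $ j) x))" for i j
      by (simp add: christoffel_def)
    have "(2 *\<^sub>R conn G x u v) $ k = (\<Sum>i\<in>UNIV. \<Sum>j\<in>UNIV. (2 * christoffel G k i j x) * u $ i * v $ j)"
      by (simp add: conn_def sum_distrib_left mult.assoc)
    also have "\<dots> = (\<Sum>i\<in>UNIV. \<Sum>j\<in>UNIV. \<Sum>l\<in>UNIV. matrix_inv (G x) $ k $ l *
       (pd i (\<lambda>y. G y $ j $ l) x + pd j (\<lambda>y. G y $ i $ l) x - pd l (\<lambda>y. G y $ i $ j) x) * u $ i * v $ j)"
      by (simp only: chr sum_distrib_right)
    also have "\<dots> = (\<Sum>i\<in>UNIV. \<Sum>l\<in>UNIV. \<Sum>j\<in>UNIV. matrix_inv (G x) $ k $ l *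
       (pd i (\<lambda>y. G y $ j $ l) x + pd j (\<lambda>y. G y $ i $ l) x - pd l (\<lambda>y. G y $ i $ j) x) * u $ i * v $ j)"
      by (rule sum.cong[OF refl], rule sum.swap)
    also have "\<dots> = (\<Sum>l\<in>UNIV. \<Sum>i\<in>UNIV. \<Sum>j\<in>UNIV. matrix_inv (G x) $ k $ l *
       (pd i (\<lambda>y. G y $ j $ l) x + pd j (\<lambda>y. G y $ i $ l) x - pd l (\<lambda>y. G y $ i $ j) x) * u $ i * v $ j)"
      by (rule sum.swap)
    finally show "(2 *\<^sub>R conn G x u v) $ k = (matrix_inv (G x) *v c) $ k"
      by (simp add: matrix_vector_mult_def c_def sum_distrib_left mult.assoc)
  qed
  then have "G x *v (2 *\<^sub>R conn G x u v) = c"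
    by (simp add: matrix_vector_mul_assoc matrix_inv_mult[OF metric_invertible[OF x]])
  then have "2 * (w \<bullet> (G x *v conn G x u v)) = w \<bullet> c"
    by (metis inner_scaleR_right linear_cmul matrix_vector_mul_linear)
  also have "w \<bullet> c = (\<Sum>l\<in>UNIV. \<Sum>i\<in>UNIV. \<Sum>j\<in>UNIV. u $ i * v $ j * w $ l * pd i (\<lambda>y. G y $ j $ l) x)
    + (\<Sum>l\<in>UNIV. \<Sum>i\<in>UNIV. \<Sum>j\<in>UNIV. u $ i * v $ j * w $ l * pd j (\<lambda>y. G y $ i $ l) x)
    - (\<Sum>l\<in>UNIV. \<Sum>i\<in>UNIV. \<Sum>j\<in>UNIV. u $ i * v $ j * w $ l * pd l (\<lambda>y. G y $ i $ j) x)"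
    by (simp add: inner_vec_def c_def sum_distrib_left sum.distrib[symmetric] sum_subtractf[symmetric]
        algebra_simps)
  also have "(\<Sum>l\<in>UNIV. \<Sum>i\<in>UNIV. \<Sum>j\<in>UNIV. u $ i * v $ j * w $ l * pd i (\<lambda>y. G y $ j $ l) x)
     = dd (\<lambda>y. v \<bullet> (G y *v w)) x u"
    unfolding dd_metric[OF x]
    by (subst sum.swap) (rule sum.cong[OF refl], subst sum.swap, simp)
  also have "(\<Sum>l\<in>UNIV. \<Sum>i\<in>UNIV. \<Sum>j\<in>UNIV. u $ i * v $ j * w $ l * pd j (\<lambda>y. G y $ i $ l) x)
     = (\<Sum>l\<in>UNIV. \<Sum>j\<in>UNIV. \<Sum>i\<in>UNIV. u $ i * v $ j * w $ l * pd j (\<lambda>y. G y $ i $ l) x)"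
    by (rule sum.cong[OF refl], rule sum.swap)
  also have "\<dots> = dd (\<lambda>y. u \<bullet> (G y *v w)) x v"
    unfolding dd_metric[OF x]
    by (subst sum.swap) (rule sum.cong[OF refl], subst sum.swap, simp add: mult_ac)
  also have "(\<Sum>l\<in>UNIV. \<Sum>i\<in>UNIV. \<Sum>j\<in>UNIV. u $ i * v $ j * w $ l * pd l (\<lambda>y. G y $ i $ j) x)
     = dd (\<lambda>y. u \<bullet> (G y *v v)) x w"
    unfolding dd_metric[OF x] by (simp add: mult_ac)
  finally show "2 * (conn G x u v \<bullet> (G x *v w)) =
     dd (\<lambda>y. v \<bullet> (G y *v w)) x u + dd (\<lambda>y. u \<bullet> (G y *v w)) x v - dd (\<lambda>y. u \<bullet> (G y *v v)) x w"
    by (simp add: metric_sym_inner[OF x])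
qed

section \<open>The coordinate curvature as the curvature of the bilinear connection\<close>

lemma dd_conn_nth:
  assumes x: "x \<in> S"
  shows "dd (\<lambda>y. conn G y v w) x u $ l =
    (\<Sum>i\<in>UNIV. \<Sum>j\<in>UNIV. \<Sum>k\<in>UNIV. pd i (christoffel G l j k) x * u $ i * v $ j * w $ k)"
proof -
  have "((\<lambda>y. conn G y v w $ l) has_derivative
    (\<lambda>u. \<Sum>j\<in>UNIV. \<Sum>k\<in>UNIV. dd (christoffel G l j k) x u * v $ j * w $ k)) (at x)"
    by (simp add: conn_def)
     (intro has_derivative_sum has_derivative_mult_left has_derivative_mult_right
        dd_has_derivative christoffel_diff x)
  then have "dd (\<lambda>y. conn G y v w $ l) x (axis i 1) =
    (\<Sum>j\<in>UNIV. \<Sum>k\<in>UNIV. pd i (christoffel G l j k) x * v $ j * w $ k)" for i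
    by (simp add: dd_eqI pd_def)
  moreover have "(\<lambda>y. conn G y v w $ l) differentiable at x"
    using \<open>(_ has_derivative _) _\<close> by (auto simp: differentiable_def)
  ultimately have "dd (\<lambda>y. conn G y v w $ l) x u =
    (\<Sum>i\<in>UNIV. u $ i * (\<Sum>j\<in>UNIV. \<Sum>k\<in>UNIV. pd i (christoffel G l j k) x * v $ j * w $ k))"
    using linear_axis_expansion[OF linear_dd, of "\<lambda>y. conn G y v w $ l" x u] by simp
  then show ?thesis using dd_nth[OF conn_diff[OF x]]
    by (simp add: sum_distrib_left mult_ac)
qed

lemma conn_conn_nth:
  "conn G x u (conn G x v w) $ l =
    (\<Sum>i\<in>UNIV. \<Sum>j\<in>UNIV. \<Sum>k\<in>UNIV.
      (\<Sum>m\<in>UNIV. christoffel G l i m x * christoffel G m j k x) * u $ i * v $ j * w $ k)"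
proof -
  have "conn G x u (conn G x v w) $ l = (\<Sum>i\<in>UNIV. \<Sum>m\<in>UNIV. \<Sum>j\<in>UNIV. \<Sum>k\<in>UNIV.
      christoffel G l i m x * christoffel G m j k x * u $ i * v $ j * w $ k)"
    by (simp add: conn_def sum_distrib_left mult_ac)
  also have "\<dots> = (\<Sum>i\<in>UNIV. \<Sum>j\<in>UNIV. \<Sum>k\<in>UNIV. \<Sum>m\<in>UNIV.
      christoffel G l i m x * christoffel G m j k x * u $ i * v $ j * w $ k)"
    by (rule sum.cong[OF refl], subst sum.swap, rule sum.cong[OF refl], rule sum.swap)
  finally show ?thesis by (simp add: sum_distrib_right)
qed

lemma curvature_op_eq_riem:
  assumes x: "x \<in> S"
  shows "curvature_op G x u v w = riem (conn G) x u v w"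
proof (intro vec_eq_iff[THEN iffD2] allI)
  fix l
  \<comment> \<open>The subtracted half of the curvature has \<open>u\<close> and \<open>v\<close>
    exchanged; renaming indices restores the common weight
    \<open>u $ i * v $ j * w $ k\<close>.\<close>
  have swap: "(\<Sum>i\<in>UNIV. \<Sum>j\<in>UNIV. \<Sum>k\<in>UNIV. F i j k * v $ i * u $ j * w $ k) =
    (\<Sum>i\<in>UNIV. \<Sum>j\<in>UNIV. \<Sum>k\<in>UNIV. F j i k * u $ i * v $ j * w $ k)" for F :: "'n \<Rightarrow> 'n \<Rightarrow> 'n \<Rightarrow> real"
    by (subst sum.swap) (simp add: mult_ac)
  have 1: "dd (\<lambda>y. conn G y u w) x v $ l =
    (\<Sum>i\<in>UNIV. \<Sum>j\<in>UNIV. \<Sum>k\<in>UNIV. pd j (christoffel G l i k) x * u $ i * v $ j * w $ k)"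
    unfolding dd_conn_nth[OF x] by (rule swap)
  have 2: "conn G x v (conn G x u w) $ l =
    (\<Sum>i\<in>UNIV. \<Sum>j\<in>UNIV. \<Sum>k\<in>UNIV.
      (\<Sum>m\<in>UNIV. christoffel G l j m x * christoffel G m i k x) * u $ i * v $ j * w $ k)"
    unfolding conn_conn_nth by (rule swap)
  show "curvature_op G x u v w $ l = riem (conn G) x u v w $ l"
    by (simp add: riem_def 1 2 dd_conn_nth[OF x, of v w u] conn_conn_nth[of x u v w]
        curvature_op_def curvature_coeff_def sum_subtractf sum.distrib
        distrib_right left_diff_distrib)
qed

end

subsection \<open>Tangent vectors and charts\<close>

text \<open>The tangent vector with components \<open>v\<close> in the chart \<open>c\<close>. For a
  chart around \<open>p\<close> this inverts evaluation at \<open>c\<close> and identifies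
  \<open>real^'n\<close> with the tangent space.\<close>

definition tangent_of ::
  "('a, 'n::finite) chart set \<Rightarrow> ('a, 'n) chart \<Rightarrow> 'a \<Rightarrow> real^'n \<Rightarrow> ('a, 'n) tangent" where
  "tangent_of A c p v = (\<lambda>c'. if c' \<in> charts_at A p then dd (snd c' \<circ> param c) (snd c p) v else 0)"

lemma coord_vector_tangent_of: "coord_vector A c i p = tangent_of A c p (axis i 1)"
  by (simp add: coord_vector_def tangent_of_def)

context
  fixes M :: "'a topology" and A :: "('a, 'n::finite) chart set"
  assumes manifold: "smooth_manifold M A"
begin

lemma chart_open: "c \<in> A \<Longrightarrow> openin M (fst c)"
  and coords_open: "c \<in> A \<Longrightarrow> open (coords c)"
  and chart_homeomorphic: "c \<in> A \<Longrightarrow>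
    homeomorphic_map (subtopology M (fst c)) (top_of_set (coords c)) (snd c)"
  using manifold by (auto simp: smooth_manifold_def smooth_atlas_def is_chart_def)

lemma chart_subset: "c \<in> A \<Longrightarrow> fst c \<subseteq> topspace M"
  by (rule openin_subset[OF chart_open])

lemma chart_inj: "c \<in> A \<Longrightarrow> inj_on (snd c) (fst c)"
  using homeomorphic_imp_injective_map[OF chart_homeomorphic] chart_subset
  by (simp add: Int_absorb1)

lemma param_snd: "c \<in> A \<Longrightarrow> p \<in> fst c \<Longrightarrow> param c (snd c p) = p"
  by (simp add: chart_inj)

lemma chart_image_open:
  assumes c: "c \<in> A" and U: "openin M U" "U \<subseteq> fst c"
  shows "open (snd c ` U)"
proof -
  have "openin (subtopology M (fst c)) U" using U by (simp add: openin_subset_topspace_eq openin_open_subtopology chart_open[OF c])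
  then have "openin (top_of_set (coords c)) (snd c ` U)"
    using homeomorphic_imp_open_map[OF chart_homeomorphic[OF c]] by (simp add: open_map_def)
  then show ?thesis using coords_open[OF c] openin_open_trans by blast
qed

lemma chart_at_in: "p \<in> topspace M \<Longrightarrow> chart_at A p \<in> charts_at A p"
proof -
  assume "p \<in> topspace M"
  then have "\<exists>c. c \<in> charts_at A p"
    using manifold by (auto simp del: split_paired_Ex simp: charts_at_def smooth_manifold_def smooth_atlas_def)
  then show ?thesis unfolding chart_at_def by (rule someI_ex)
qed

lemma overlap_open: "c \<in> A \<Longrightarrow> c' \<in> A \<Longrightarrow> open (snd c ` (fst c \<inter> fst c'))"
  by (rule chart_image_open) (auto simp: chart_open)

lemma transition_differentiable:
  assumes c: "c \<in> charts_at A p" "c' \<in> charts_at A p"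
  shows "(snd c' \<circ> param c) differentiable at (snd c p)"
proof -
  have "smooth_on (snd c ` (fst c \<inter> fst c')) (snd c' \<circ> param c)"
    using manifold c by (auto simp: smooth_manifold_def smooth_atlas_def charts_at_def)
  then show ?thesis using c by (intro smooth_on_differentiable) (auto simp: charts_at_def)
qed

text \<open>The chain rule through a transition map. The target of \<open>\<psi>\<close> is left
  open so that it covers coordinate maps, real functions and coordinate maps composed with a map of
  the manifold.\<close>

lemma change_chart:
  fixes \<psi> :: "'a \<Rightarrow> 'b::real_normed_vector"
  assumes c: "c \<in> charts_at A p" "c' \<in> charts_at A p"
    and \<psi>: "(\<psi> \<circ> param c') differentiable at (snd c' p)"
  shows "dd (\<psi> \<circ> param c) (snd c p) v =
      dd (\<psi> \<circ> param c') (snd c' p) (dd (snd c' \<circ> param c) (snd c p) v)"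
proof -
  have A: "c \<in> A" "c' \<in> A" "p \<in> fst c" "p \<in> fst c'" using c by (auto simp: charts_at_def)
  have eq: "(\<psi> \<circ> param c') ((snd c' \<circ> param c) y) = (\<psi> \<circ> param c) y"
    if "y \<in> snd c ` (fst c \<inter> fst c')" for y
    using that A by (auto simp: param_snd)
  have in1: "snd c p \<in> snd c ` (fst c \<inter> fst c')" using A by auto
  have val: "(snd c' \<circ> param c) (snd c p) = snd c' p" using A by (simp add: param_snd)
  note t = transition_differentiable[OF c]
  have "dd (\<lambda>y. (\<psi> \<circ> param c') ((snd c' \<circ> param c) y)) (snd c p) v =
      dd (\<psi> \<circ> param c') (snd c' p) (dd (snd c' \<circ> param c) (snd c p) v)"
    using dd_compose[OF t, of "\<psi> \<circ> param c'" v] \<psi> unfolding val .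
  moreover have "dd (\<lambda>y. (\<psi> \<circ> param c') ((snd c' \<circ> param c) y)) (snd c p) = dd (\<psi> \<circ> param c) (snd c p)"
    by (rule dd_cong[OF overlap_open[OF A(1,2)] in1 eq])
  ultimately show "dd (\<psi> \<circ> param c) (snd c p) v =
      dd (\<psi> \<circ> param c') (snd c' p) (dd (snd c' \<circ> param c) (snd c p) v)" by simp
qed

lemma dd_transition_self:
  assumes "c \<in> charts_at A p"
  shows "dd (snd c \<circ> param c) (snd c p) v = v"
proof -
  have c: "c \<in> A" "p \<in> fst c" using assms by (auto simp: charts_at_def)
  have "dd (snd c \<circ> param c) (snd c p) = dd (\<lambda>x. x) (snd c p)"
    by (rule dd_cong[OF coords_open[OF c(1)]]) (use c in \<open>auto simp: param_snd\<close>)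
  then show ?thesis by simp
qed

lemma tangent_of_self: "c \<in> charts_at A p \<Longrightarrow> tangent_of A c p v c = v"
  by (simp add: tangent_of_def dd_transition_self)

text \<open>Compatibility of the components is the chain rule for transition maps,
  \<open>change_chart\<close> applied to a coordinate map.\<close>

lemma tangent_of_in: "c \<in> charts_at A p \<Longrightarrow> tangent_of A c p v \<in> tangent_space A p"
  by (simp add: tangent_space_def tangent_of_def change_chart[symmetric] transition_differentiable)

lemma tangent_of_component:
  assumes u: "u \<in> tangent_space A p" and c: "c \<in> charts_at A p"
  shows "tangent_of A c p (u c) = u"
proof (rule ext)
  fix c'
  note u' = u[unfolded tangent_space_def mem_Collect_eq]
  show "tangent_of A c p (u c) c' = u c'"
    unfolding tangent_of_def
    using conjunct1[OF u', rule_format, of c'] conjunct2[OF u', rule_format, OF c, of c']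
    by (cases "c' \<in> charts_at A p") simp_all
qed

lemma tangent_of_linear:
  "c \<in> charts_at A p \<Longrightarrow>
    tangent_of A c p (a *\<^sub>R v + b *\<^sub>R w) = (\<lambda>c'. a *\<^sub>R tangent_of A c p v c' + b *\<^sub>R tangent_of A c p w c')"
  by (rule ext) (simp add: tangent_of_def linear_add[OF linear_dd[OF transition_differentiable]]
      linear_cmul[OF linear_dd[OF transition_differentiable]])

lemma tangent_of_eq_0: "c \<in> charts_at A p \<Longrightarrow> tangent_of A c p v = (\<lambda>c. 0) \<Longrightarrow> v = 0"
  by (drule fun_cong[of _ _ c]) (simp add: tangent_of_self)

text \<open>Frees \<open>differential\<close> from the chart chosen at \<open>p\<close>. This
  matters when \<open>p\<close> varies inside one fixed chart, because \<open>chart_at\<close> may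
  then change from point to point.\<close>

lemma differential_tangent_of:
  assumes p: "p \<in> topspace M" and c: "c \<in> charts_at A p" and f: "smooth_function A f"
  shows "differential A f p (tangent_of A c p v) = dd (f \<circ> param c) (snd c p) v"
proof -
  have "(f \<circ> param (chart_at A p)) differentiable at (snd (chart_at A p) p)"
    using f chart_at_in[OF p]
    by (intro smooth_on_differentiable[of "coords (chart_at A p)"])
       (auto simp: smooth_function_def charts_at_def)
  from change_chart[OF c chart_at_in[OF p] this] show ?thesis
    using chart_at_in[OF p] by (simp add: differential_def Let_def tangent_of_def)
qed

text \<open>Smoothness is known chart by chart, so global continuity is obtained by pasting over the
  atlas; compactness does the rest.\<close>

lemma smooth_function_attains_max:
  assumes "compact_space M" "topspace M \<noteq> {}" and f: "smooth_function A f"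
  obtains p where "p \<in> topspace M" "\<And>q. q \<in> topspace M \<Longrightarrow> f q \<le> f p"
proof -
  have "continuous_map M euclideanreal f"
  proof (rule pasting_lemma[where I = A and T = fst and f = "\<lambda>_. f"])
    fix c assume c: "c \<in> A"
    have "continuous_on (coords c) (f \<circ> param c)"
      using f c by (intro smooth_on_continuous) (simp add: smooth_function_def)
    then have "continuous_map (top_of_set (coords c)) euclideanreal (f \<circ> param c)" by simp
    from continuous_map_compose[OF homeomorphic_imp_continuous_map[OF chart_homeomorphic[OF c]] this]
    show "continuous_map (subtopology M (fst c)) euclideanreal f"
      by (rule continuous_map_eq) (auto simp: param_snd[OF c])
  next
    fix p assume "p \<in> topspace M"
    then show "\<exists>c. c \<in> A \<and> p \<in> fst c \<and> f p = f p"
      using chart_at_in[of p] by (auto simp del: split_paired_Ex simp: charts_at_def)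
  qed (auto simp: chart_open)
  then have "compact (f ` topspace M)"
    using image_compactin[of M "topspace M" euclideanreal f] assms(1) by (simp add: compact_space_def)
  from compact_attains_sup[OF this] assms(2) that show thesis by auto
qed

end

section \<open>The metric in the components of a chart\<close>

context
  fixes M :: "'a topology" and A :: "('a, 'n::finite) chart set" and g :: "('a, 'n) metric"
  assumes manifold: "smooth_manifold M A" and metric: "riemannian_metric M A g"
begin

lemmas metric_pointwise = conjunct1[OF metric[unfolded riemannian_metric_def], rule_format]

lemma metric_linear_left:
  assumes "p \<in> topspace M" "u \<in> tangent_space A p" "v \<in> tangent_space A p" "w \<in> tangent_space A p"
  shows "g p (\<lambda>c. a *\<^sub>R u c + b *\<^sub>R v c) w = a * g p u w + b * g p v w"
  by (rule conjunct2[OF conjunct2[OF metric_pointwise], rule_format]) (rule assms)+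

lemma metric_symmetric:
  assumes "p \<in> topspace M" "u \<in> tangent_space A p" "v \<in> tangent_space A p"
  shows "g p u v = g p v u"
  by (rule conjunct1[OF metric_pointwise]) (rule assms)+

lemma metric_positive:
  assumes "p \<in> topspace M" "v \<in> tangent_space A p" "v \<noteq> (\<lambda>c. 0)"
  shows "g p v v > 0"
  using conjunct1[OF conjunct2[OF metric_pointwise[OF assms(1,2,2)]]] assms(3) by (rule mp)

text \<open>Both arguments expand in the coordinate vectors, which are \<open>tangent_of\<close>
  applied to \<open>axis\<close> vectors, and their products are the entries of the matrix.\<close>

lemma metric_tangent_of:
  assumes p: "p \<in> topspace M" and c: "c \<in> charts_at A p"
  shows "g p (tangent_of A c p v) (tangent_of A c p w) = v \<bullet> (metric_matrix A g c (snd c p) *v w)"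
proof -
  let ?T = "tangent_of A c p"
  note T = tangent_of_in[OF manifold c]
  have comb: "g p (?T (a *\<^sub>R v + b *\<^sub>R v')) (?T w) = a * g p (?T v) (?T w) + b * g p (?T v') (?T w)" for a b v v' w
    by (simp add: tangent_of_linear[OF manifold c] metric_linear_left p T)
  have l1: "linear (\<lambda>v. g p (?T v) (?T w))" for w
    using comb[of 1 _ 1] comb[of _ _ 0 0] by (auto intro!: linearI)
  have l2: "linear (\<lambda>w. g p (?T v) (?T w))" for v
    using l1[of v] metric_symmetric[OF p T T] by (simp add: linear_iff)
  have pc: "param c (snd c p) = p" using c by (simp add: param_snd[OF manifold] charts_at_def)
  have "g p (?T v) (?T w) = (\<Sum>i\<in>UNIV. v $ i * (\<Sum>j\<in>UNIV. w $ j * g p (?T (axis i 1)) (?T (axis j 1))))"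
    unfolding linear_axis_expansion[OF l1, of v w]
    by (subst linear_axis_expansion[OF l2, of _ w]) simp
  then show ?thesis
    by (simp add: inner_matrix_vector metric_matrix_def pc coord_vector_tangent_of sum_distrib_left mult_ac)
qed

lemma metric_component:
  assumes "p \<in> topspace M" "c \<in> charts_at A p" "u \<in> tangent_space A p" "v \<in> tangent_space A p"
  shows "g p u v = u c \<bullet> (metric_matrix A g c (snd c p) *v v c)"
  using metric_tangent_of[OF assms(1,2), of "u c" "v c"]
  unfolding tangent_of_component[OF manifold assms(3,2)] tangent_of_component[OF manifold assms(4,2)] .

lemma smooth_metric_matrix:
  assumes c: "c \<in> A"
  shows "smooth_metric (coords c) (metric_matrix A g c)"
  unfolding smooth_metric_def
proof (intro conjI allI ballI impI)
  show "open (coords c)" by (rule coords_open[OF manifold c])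
  show "smooth_on (coords c) (\<lambda>x. metric_matrix A g c x $ i $ j)" for i j
    by (rule conjunct2[OF metric[unfolded riemannian_metric_def], rule_format]) (rule c)
  fix x assume "x \<in> coords c"
  then obtain p where p: "p \<in> fst c" "x = snd c p" by auto
  have p': "p \<in> topspace M" "c \<in> charts_at A p"
    using p c chart_subset[OF manifold c] by (auto simp: charts_at_def)
  show "metric_matrix A g c x $ i $ j = metric_matrix A g c x $ j $ i" for i j
    using metric_symmetric[OF p'(1) tangent_of_in[OF manifold p'(2)] tangent_of_in[OF manifold p'(2)]]
    by (simp add: metric_matrix_def p param_snd[OF manifold c] coord_vector_tangent_of)
  show "v \<bullet> (metric_matrix A g c x *v v) > 0" if "v \<noteq> 0" for v
    unfolding p(2) metric_tangent_of[OF p', symmetric]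
    using metric_positive[OF p'(1) tangent_of_in[OF manifold p'(2)]]
      tangent_of_eq_0[OF manifold p'(2)] that by metis
qed

end

subsection \<open>Interior maxima\<close>

text \<open>Were the second derivative along \<open>v\<close> positive, the first derivative, zero
  at \<open>x\<close>, would be positive just after \<open>x\<close> on the line, and the mean value
  theorem would produce a larger value of \<open>h\<close>.\<close>

lemma second_derivative_max:
  fixes h :: "'e::euclidean_space \<Rightarrow> real"
  assumes S: "open S" and h: "smooth_on S h" and x: "x \<in> S" and max: "\<And>y. y \<in> S \<Longrightarrow> h y \<le> h x"
  shows "dd h x v = 0" and "dd (\<lambda>y. dd h y v) x v \<le> 0"
proof -
  have "dd h x = (\<lambda>v. 0)"
    by (rule differential_zero_maxmin[OF x S dd_has_derivative[OF smooth_on_differentiable[OF h x]]])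
       (use max in blast)
  then show 0: "dd h x v = 0" by simp
  show "dd (\<lambda>y. dd h y v) x v \<le> 0"
  proof (rule ccontr)
    assume "\<not> ?thesis"
    then have pos: "dd (\<lambda>y. dd h y v) x v > 0" by simp
    have "((\<lambda>s. dd h (x + s *\<^sub>R v) v) has_real_derivative dd (\<lambda>y. dd h y v) x v) (at 0)"
      using has_real_derivative_along_line[of "\<lambda>y. dd h y v" x 0 v]
        smooth_on_differentiable[OF smooth_on_dd[OF h] x] by simp
    from DERIV_pos_inc_right[OF this pos] obtain d
      where d: "d > 0" "\<And>s. 0 < s \<Longrightarrow> s < d \<Longrightarrow> dd h (x + s *\<^sub>R v) v > 0"
      by (auto simp: 0)
    obtain r where r: "r > 0" "ball x r \<subseteq> S" using S x by (meson openE)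
    \<comment> \<open>The first bound gives \<open>t < d\<close>, the second keeps the segment in
      the ball; the added 1 covers \<open>v = 0\<close>.\<close>
    define t where "t = min (d / 2) (r / (2 * (norm v + 1)))"
    have nv: "norm v + 1 > 0" by (simp add: add_nonneg_pos)
    have t: "t > 0" "t < d" using d r nv by (auto simp: t_def)
    have "t * norm v < r"
    proof -
      have "t * norm v \<le> r / (2 * (norm v + 1)) * norm v" by (intro mult_right_mono) (auto simp: t_def)
      also have "\<dots> < r" using r nv by (simp add: field_simps) (smt (verit) mult_nonneg_nonneg norm_ge_zero)
      finally show ?thesis .
    qed
    then have mem: "x + s *\<^sub>R v \<in> S" if "0 \<le> s" "s \<le> t" for s
      using r that mult_right_mono[of s t "norm v"] by (intro subsetD[OF r(2)]) (simp add: dist_norm)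
    have "\<exists>s. 0 < s \<and> s < t \<and> h (x + t *\<^sub>R v) - h (x + 0 *\<^sub>R v) = (t - 0) * dd h (x + s *\<^sub>R v) v"
      using t mem by (intro MVT2 has_real_derivative_along_line smooth_on_differentiable[OF h]) auto
    then obtain s where "0 < s" "s < t" "h (x + t *\<^sub>R v) - h x = t * dd h (x + s *\<^sub>R v) v" by auto
    then have "h (x + t *\<^sub>R v) > h x" using d(2)[of s] t by (smt (verit) mult_pos_pos)
    then show False using max[OF mem[of t]] t by simp
  qed
qed

lemma second_derivative_eq_sum_pd:
  fixes h :: "real^'n::finite \<Rightarrow> real"
  assumes S: "open S" and h: "smooth_on S h" and x: "x \<in> S"
  shows "dd (\<lambda>y. dd h y v) x u = (\<Sum>i\<in>UNIV. \<Sum>j\<in>UNIV. u $ i * v $ j * pd i (pd j h) x)"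
proof -
  have d: "pd j h differentiable at x" for j
    unfolding pd_def[abs_def] by (rule smooth_on_differentiable[OF smooth_on_dd[OF h] x])
  have "dd (\<lambda>y. dd h y v) x = dd (\<lambda>y. \<Sum>j\<in>UNIV. v $ j * pd j h y) x"
    by (rule dd_cong[OF S x]) (simp add: dd_eq_sum_pd smooth_on_differentiable[OF h])
  also have "\<dots> = (\<lambda>u. \<Sum>j\<in>UNIV. v $ j * dd (pd j h) x u)"
    by (intro dd_eqI has_derivative_sum has_derivative_mult_right dd_has_derivative d)
  finally have "dd (\<lambda>y. dd h y v) x u = (\<Sum>j\<in>UNIV. \<Sum>i\<in>UNIV. u $ i * v $ j * pd i (pd j h) x)"
    by (simp add: dd_eq_sum_pd[OF d] sum_distrib_left mult_ac)
  then show ?thesis by (subst sum.swap)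
qed

subsection \<open>Isometries\<close>

context
  fixes M :: "'a topology" and A :: "('a, 'n::finite) chart set" and F :: "'a \<Rightarrow> 'a"
  assumes manifold: "smooth_manifold M A" and F: "smooth_map M A F"
begin

lemma smooth_map_domain_open:
  assumes "c \<in> A" "c' \<in> A"
  shows "open (snd c ` (fst c \<inter> F -` fst c'))"
proof (rule chart_image_open[OF manifold assms(1)])
  have "openin M {x \<in> topspace M. F x \<in> fst c'}"
    using F chart_open[OF manifold assms(2)] by (auto simp: smooth_map_def intro: openin_continuous_map_preimage)
  then have "openin M (fst c \<inter> {x \<in> topspace M. F x \<in> fst c'})"
    using chart_open[OF manifold assms(1)] by (rule openin_Int[rotated])
  moreover have "fst c \<inter> {x \<in> topspace M. F x \<in> fst c'} = fst c \<inter> F -` fst c'"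
    using chart_subset[OF manifold assms(1)] by auto
  ultimately show "openin M (fst c \<inter> F -` fst c')" by simp
qed auto

lemma smooth_map_smooth:
  "c \<in> A \<Longrightarrow> c' \<in> A \<Longrightarrow> smooth_on (snd c ` (fst c \<inter> F -` fst c')) (snd c' \<circ> F \<circ> param c)"
  using F by (simp add: smooth_map_def)

lemma smooth_map_differentiable:
  assumes "c \<in> charts_at A p" "c' \<in> charts_at A (F p)"
  shows "(snd c' \<circ> F \<circ> param c) differentiable at (snd c p)"
  using assms by (intro smooth_on_differentiable[OF smooth_map_smooth]) (auto simp: charts_at_def)

text \<open>Replaces the chart built into \<open>pushforward\<close> by arbitrary charts:
  \<open>change_chart\<close> handles the source, and the chain rule through \<open>c'\<close> the
  target.\<close>

lemma pushforward_eq_tangent_of: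
  assumes p: "p \<in> topspace M" and c: "c \<in> charts_at A p" and c': "c' \<in> charts_at A (F p)"
    and u: "u \<in> tangent_space A p"
  shows "pushforward A F p u =
    tangent_of A c' (F p) (dd (snd c' \<circ> F \<circ> param c) (snd c p) (u c))"
proof (rule ext)
  fix c''
  show "pushforward A F p u c'' =
    tangent_of A c' (F p) (dd (snd c' \<circ> F \<circ> param c) (snd c p) (u c)) c''"
  proof (cases "c'' \<in> charts_at A (F p)")
    case c'': True
    let ?d = "chart_at A p" and ?S = "snd c ` (fst c \<inter> F -` fst c')" and ?\<phi> = "snd c' \<circ> F \<circ> param c"
    have A: "c \<in> A" "c' \<in> A" "p \<in> fst c" "F p \<in> fst c'" using c c' by (auto simp: charts_at_def)
    have d: "?d \<in> charts_at A p" by (rule chart_at_in[OF manifold p])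
    have val: "?\<phi> (snd c p) = snd c' (F p)" using A by (simp add: param_snd[OF manifold])
    have "tangent_of A c p (u c) ?d = u ?d" by (simp only: tangent_of_component[OF manifold u c])
    then have "u ?d = dd (snd ?d \<circ> param c) (snd c p) (u c)" using d by (simp add: tangent_of_def)
    then have "dd (snd c'' \<circ> F \<circ> param ?d) (snd ?d p) (u ?d) = dd (snd c'' \<circ> F \<circ> param c) (snd c p) (u c)"
      using change_chart[OF manifold c d smooth_map_differentiable[OF d c''], of "u c"] by simp
    also have "dd (snd c'' \<circ> F \<circ> param c) (snd c p) = dd (\<lambda>y. (snd c'' \<circ> param c') (?\<phi> y)) (snd c p)"
      by (rule dd_cong[OF smooth_map_domain_open[OF A(1,2)]])
         (use A in \<open>auto simp: param_snd[OF manifold]\<close>)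
    also have "dd (\<lambda>y. (snd c'' \<circ> param c') (?\<phi> y)) (snd c p) (u c) = dd (snd c'' \<circ> param c') (snd c' (F p)) (dd ?\<phi> (snd c p) (u c))"
      unfolding val[symmetric]
      by (rule dd_compose[OF smooth_map_differentiable[OF c c']])
         (simp only: val transition_differentiable[OF manifold c' c''])
    finally show ?thesis by (simp only: pushforward_def Let_def tangent_of_def c'' if_True)
  qed (simp add: pushforward_def tangent_of_def)
qed

end

text \<open>With \<open>\<phi>\<close> the expression of \<open>F\<close> in the charts that
  \<open>sec\<close> uses, \<open>riem_transform\<close> and preservation of the metric match the
  numerators, and preservation alone matches the denominators.\<close>

lemma sec_isometry:
  assumes manifold: "smooth_manifold M A" and metric: "riemannian_metric M A g"
    and F: "isometry M A g F" and p: "p \<in> topspace M"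
    and u: "u \<in> tangent_space A p" and v: "v \<in> tangent_space A p"
  shows "sec A g (F p) (pushforward A F p u) (pushforward A F p v) = sec A g p u v"
proof -
  have sm: "smooth_map M A F" and bij: "bij_betw F (topspace M) (topspace M)"
    using F by (simp_all add: isometry_def)
  have iso: "g (F p) (pushforward A F p u) (pushforward A F p v) = g p u v"
    if "p \<in> topspace M" "u \<in> tangent_space A p" "v \<in> tangent_space A p" for p u v
    using F that by (simp add: isometry_def)
  have Fp: "F p \<in> topspace M" using bij p by (auto simp: bij_betw_def)
  define c where "c = chart_at A p"
  define c' where "c' = chart_at A (F p)"
  have c: "c \<in> charts_at A p" unfolding c_def by (rule chart_at_in[OF manifold p])
  have c': "c' \<in> charts_at A (F p)" unfolding c'_def by (rule chart_at_in[OF manifold Fp])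
  have A: "c \<in> A" "c' \<in> A" "p \<in> fst c" "F p \<in> fst c'" using c c' by (auto simp: charts_at_def)
  define S where "S = snd c ` (fst c \<inter> F -` fst c')"
  define \<phi> where "\<phi> = snd c' \<circ> F \<circ> param c"
  define G where "G = metric_matrix A g c"
  define H where "H = metric_matrix A g c'"
  have G: "smooth_metric (coords c) G" and H: "smooth_metric (coords c') H"
    unfolding G_def H_def by (rule smooth_metric_matrix[OF manifold metric] A)+
  have SG: "x \<in> coords c" if "x \<in> S" for x using that by (auto simp: S_def)
  have smooth: "smooth_on S \<phi>"
    unfolding S_def \<phi>_def by (rule smooth_map_smooth[OF manifold sm A(1,2)])
  have \<phi>S: "\<phi> x \<in> coords c'" if "x \<in> S" for x
    using that A by (auto simp: S_def \<phi>_def param_snd[OF manifold])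
  \<comment> \<open>The identity is needed on all of \<open>S\<close>, not only at \<open>p\<close>,
    since the connection involves derivatives of the metric.\<close>
  have isom: "a \<bullet> (G x *v b) = dd \<phi> x a \<bullet> (H (\<phi> x) *v dd \<phi> x b)" if x: "x \<in> S" for x a b
  proof -
    from x obtain q where q: "q \<in> fst c" "F q \<in> fst c'" "x = snd c q" by (auto simp: S_def)
    have cq: "c \<in> charts_at A q" "c' \<in> charts_at A (F q)" using q A by (auto simp: charts_at_def)
    have qM: "q \<in> topspace M" "F q \<in> topspace M"
      using q chart_subset[OF manifold A(1)] chart_subset[OF manifold A(2)] by auto
    note T = tangent_of_in[OF manifold cq(1)]
    have \<phi>x: "\<phi> x = snd c' (F q)" using q A by (simp add: \<phi>_def param_snd[OF manifold])
    have push: "pushforward A F q (tangent_of A c q a) = tangent_of A c' (F q) (dd \<phi> x a)" for a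
      using pushforward_eq_tangent_of[OF manifold sm qM(1) cq T]
      by (simp add: tangent_of_self[OF manifold cq(1)] \<phi>_def q(3))
    show ?thesis
      using iso[OF qM(1) T T, of a b]
      unfolding push metric_tangent_of[OF manifold metric qM(1) cq(1)]
        metric_tangent_of[OF manifold metric qM(2) cq(2)]
      by (simp add: G_def H_def \<phi>x[unfolded q(3)] q(3))
  qed
  \<comment> \<open>A vector killed by the differential has length zero in \<open>G x\<close>, so
    the differential is injective, hence surjective in equal finite dimensions.\<close>
  have surj: "surj (dd \<phi> x)" if x: "x \<in> S" for x
  proof -
    note lin = linear_dd[OF smooth_on_differentiable[OF smooth x]]
    have "a = 0" if "dd \<phi> x a = 0" for a
      using isom[OF x, of a a] metric_pos[OF G SG[OF x], of a] that by fastforce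
    then show ?thesis
      using lin linear_injective_0[OF lin] linear_injective_imp_surjective by blast
  qed
  interpret local_isometry S "coords c'" \<phi> "\<lambda>x a b. a \<bullet> (G x *v b)" "\<lambda>z a b. a \<bullet> (H z *v b)" "conn G" "conn H"
  proof
    show "open S" unfolding S_def by (rule smooth_map_domain_open[OF manifold sm A(1,2)])
    show "a = 0" if "z \<in> coords c'" "\<And>b. a \<bullet> (H z *v b) = 0" for z a
      using metric_pos[OF H that(1), of a] that(2)[of a] by force
  qed (fact smooth \<phi>S bilinear_inner_matrix metric_sym_inner[OF H] inner_metric_diff[OF H]
      isom surj bilinear_conn conn_diff[OF G SG] conn_diff[OF H] conn_koszul[OF G SG] conn_koszul[OF H])+
  define x where "x = snd c p"
  have x: "x \<in> S" using A by (simp add: x_def S_def)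
  have \<phi>x: "\<phi> x = snd c' (F p)" using A by (simp add: \<phi>_def x_def param_snd[OF manifold])
  have push: "pushforward A F p w c' = dd \<phi> x (w c)" if "w \<in> tangent_space A p" for w
    using pushforward_eq_tangent_of[OF manifold sm p c c' that] tangent_of_self[OF manifold c']
    by (simp add: \<phi>_def x_def)
  have "(H (\<phi> x) *v curvature_op H (\<phi> x) (dd \<phi> x (u c)) (dd \<phi> x (v c)) (dd \<phi> x (v c))) \<bullet> dd \<phi> x (u c)
      = (G x *v curvature_op G x (u c) (v c) (v c)) \<bullet> u c"
    unfolding curvature_op_eq_riem[OF H \<phi>S[OF x]] curvature_op_eq_riem[OF G SG[OF x]]
    by (simp add: riem_transform[OF x, symmetric] inner_commute[of "_ *v _"] isom[OF x, symmetric])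
  then show ?thesis
    unfolding sec_def Let_def c_def[symmetric] c'_def[symmetric] G_def[symmetric] H_def[symmetric]
      push[OF u] push[OF v] iso[OF p u u] iso[OF p v v] iso[OF p u v] \<phi>x[symmetric] x_def[symmetric]
    by simp
qed

subsection \<open>Maximum points of the potential\<close>

context
  fixes M :: "'a topology" and A :: "('a, 'n::finite) chart set" and g :: "('a, 'n) metric"
    and p :: 'a and f :: "'a \<Rightarrow> real"
  assumes manifold: "smooth_manifold M A" and metric: "riemannian_metric M A g"
    and f: "smooth_function A f" and p: "p \<in> topspace M"
    and max: "\<And>q. q \<in> topspace M \<Longrightarrow> f q \<le> f p"
begin

private abbreviation "c \<equiv> chart_at A p"
private abbreviation "h \<equiv> f \<circ> param c"
private abbreviation "x \<equiv> snd c p"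

lemma chart_at_max: "c \<in> charts_at A p" "c \<in> A" "p \<in> fst c"
  using chart_at_in[OF manifold p] by (auto simp: charts_at_def)

lemma smooth_at_max_chart: "smooth_on (coords c) h" using f chart_at_max by (simp add: smooth_function_def)

lemma coords_at_max: "x \<in> coords c" using chart_at_max by simp

lemma local_max: "y \<in> coords c \<Longrightarrow> h y \<le> h x"
  using max chart_subset[OF manifold chart_at_max(2)] chart_at_max by (auto simp: param_snd[OF manifold])

lemmas first_second_derivative_at_max =
  second_derivative_max[OF coords_open[OF manifold chart_at_max(2)] smooth_at_max_chart coords_at_max local_max]

lemma pd_at_max: "pd k h x = 0"
  unfolding pd_def by (rule first_second_derivative_at_max(1))

lemma max_hessian_sum: "(\<Sum>i\<in>UNIV. \<Sum>j\<in>UNIV. v c $ i * v c $ j * pd i (pd j h) x) \<le> 0"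
  using first_second_derivative_at_max(2)
  unfolding second_derivative_eq_sum_pd[OF coords_open[OF manifold chart_at_max(2)] smooth_at_max_chart coords_at_max] .

lemma differential_at_max: "differential A f p v = 0"
  by (simp add: differential_def Let_def first_second_derivative_at_max(1))

text \<open>The Christoffel terms multiply first partial derivatives, which vanish here, so only the
  ordinary second derivative remains.\<close>

lemma hessian_at_max: "hessian A g f p v v \<le> 0"
  using max_hessian_sum[of v] by (simp add: hessian_def Let_def pd_at_max)

text \<open>The gradient vanishes at \<open>p\<close> because its squared length is
  \<open>df\<close> applied to itself. The surviving terms of the Lie derivative are then
  derivatives of \<open>Y\<close>, and differentiating the gradient equation turns them into second
  derivatives of \<open>h\<close>.\<close>

lemma lie_derivative_at_max:
  assumes X: "smooth_vector_field M A X" and grad: "is_gradient M A g X f"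
  shows "lie_derivative_metric A g X p v v \<le> 0"
proof -
  define G where "G = metric_matrix A g c"
  define Y where "Y k y = X (param c y) c $ k" for k y
  have G: "smooth_metric (coords c) G"
    unfolding G_def by (rule smooth_metric_matrix[OF manifold metric chart_at_max(2)])
  have "X p \<in> tangent_space A p" and "g p (X p) (X p) = differential A f p (X p)"
    using grad p by (auto simp: is_gradient_def)
  then have X0: "X p = (\<lambda>c. 0)"
    using metric_positive[OF manifold metric p, of "X p"] differential_at_max by force
  have Y0: "Y k x = 0" for k using X0 chart_at_max by (simp add: Y_def param_snd[OF manifold])
  have Yd: "Y k differentiable at x" for k
  proof -
    have "(\<lambda>y. X (param c y) c) differentiable at x"
      using X chart_at_max coords_at_max by (intro smooth_on_differentiable[of "coords c"]) (auto simp: smooth_vector_field_def)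
    then show ?thesis unfolding Y_def[abs_def]
      using bounded_linear.has_derivative[OF bounded_linear_vec_nth]
      unfolding differentiable_def by blast
  qed
  \<comment> \<open>The gradient equation in components, on the whole chart so that it can be
    differentiated at \<open>x\<close>.\<close>
  have pdh: "pd j h y = (\<Sum>k\<in>UNIV. G y $ j $ k * Y k y)" if y: "y \<in> coords c" for j y
  proof -
    from y obtain q where q: "q \<in> fst c" "y = snd c q" by auto
    have qM: "q \<in> topspace M" "c \<in> charts_at A q"
      using q chart_at_max(2) chart_subset[OF manifold chart_at_max(2)] by (auto simp: charts_at_def)
    note T = tangent_of_in[OF manifold qM(2), of "axis j 1"]
    have Xq: "X q \<in> tangent_space A q" using grad qM by (auto simp: is_gradient_def)
    have "pd j h y = differential A f q (tangent_of A c q (axis j 1))"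
      by (simp add: differential_tangent_of[OF manifold qM f] pd_def q)
    also have "\<dots> = g q (X q) (tangent_of A c q (axis j 1))"
      using grad qM(1) T by (simp add: is_gradient_def)
    also have "\<dots> = g q (tangent_of A c q (axis j 1)) (X q)"
      by (rule metric_symmetric[OF manifold metric qM(1) Xq T])
    also have "\<dots> = axis j 1 \<bullet> (G y *v X q c)"
      by (simp only: metric_component[OF manifold metric qM T Xq] tangent_of_self[OF manifold qM(2)]
          G_def q(2))
    also have "\<dots> = (\<Sum>k\<in>UNIV. G y $ j $ k * Y k y)"
      using q chart_at_max by (simp add: inner_axis' matrix_vector_mult_def Y_def param_snd[OF manifold])
    finally show ?thesis .
  qed
  \<comment> \<open>In the product rule the derivatives of the metric are multiplied by
    \<open>Y\<close>, which is zero at \<open>x\<close>.\<close>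
  have pd2: "pd i (pd j h) x = (\<Sum>k\<in>UNIV. pd i (Y k) x * G x $ k $ j)" for i j
  proof -
    have "dd (pd j h) x = dd (\<lambda>y. \<Sum>k\<in>UNIV. G y $ j $ k * Y k y) x"
      by (rule dd_cong[OF coords_open[OF manifold chart_at_max(2)] coords_at_max pdh])
    also have "\<dots> = (\<lambda>u. \<Sum>k\<in>UNIV. G x $ j $ k * dd (Y k) x u + dd (\<lambda>y. G y $ j $ k) x u * Y k x)"
      by (intro dd_eqI has_derivative_sum has_derivative_mult dd_has_derivative Yd metric_diff[OF G coords_at_max])
    finally show ?thesis
      by (simp add: pd_def Y0 mult.commute metric_sym[OF G coords_at_max, of j])
  qed
  have "lie_derivative_metric A g X p v v = (\<Sum>i\<in>UNIV. \<Sum>j\<in>UNIV. v c $ i * v c $ j *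
       (\<Sum>k\<in>UNIV. Y k x * pd k (\<lambda>y. G y $ i $ j) x
                 + pd i (Y k) x * G x $ k $ j + pd j (Y k) x * G x $ i $ k))"
    by (simp add: lie_derivative_metric_def Let_def G_def Y_def[abs_def])
  also have "\<dots> = (\<Sum>i\<in>UNIV. \<Sum>j\<in>UNIV. v c $ i * v c $ j * (pd i (pd j h) x + pd j (pd i h) x))"
    by (simp add: Y0 pd2 sum.distrib metric_sym[OF G coords_at_max, of _ i for i])
  also have "\<dots> = (\<Sum>i\<in>UNIV. \<Sum>j\<in>UNIV. v c $ i * v c $ j * pd i (pd j h) x)
     + (\<Sum>i\<in>UNIV. \<Sum>j\<in>UNIV. v c $ i * v c $ j * pd j (pd i h) x)"
    by (simp only: distrib_left sum.distrib)
  \<comment> \<open>The weight is symmetric in the indices, so renaming them is enough and partial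
    derivatives need not be commuted.\<close>
  also have "(\<Sum>i\<in>UNIV. \<Sum>j\<in>UNIV. v c $ i * v c $ j * pd j (pd i h) x) =
     (\<Sum>i\<in>UNIV. \<Sum>j\<in>UNIV. v c $ i * v c $ j * pd i (pd j h) x)"
    by (subst sum.swap) (simp only: mult.commute mult.left_commute)
  finally show ?thesis using max_hessian_sum[of v] by (simp add: o_def)
qed

end

theorem theorem2:
  fixes M :: "'a topology" and A :: "('a, 'n::finite) chart set" and g :: "('a, 'n) metric"
  assumes "smooth_manifold M A"
    and "riemannian_metric M A g"
    and "compact_space M"
    and "homogeneous M A g"
    and "\<exists>X f. smooth_vector_field M A X \<and> smooth_function A f \<and> is_gradient M A g X f \<and>
           positive_weighted_sec M A g X"
  shows "positive_sec M A g"
  unfolding positive_sec_def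
proof (intro ballI allI impI)
  fix p u v assume p: "p \<in> topspace M" and uv: "orthonormal_pair A g p u v"
  note manifold = assms(1) and metric = assms(2)
  \<comment> \<open>Stated for every smooth function: the alternative with \<open>sec_bar\<close>
    supplies its own potential, and the maximum point must belong to that one.\<close>
  have attains: "\<exists>q\<in>topspace M. \<forall>q'\<in>topspace M. f q' \<le> f q" if "smooth_function A f" for f
  proof -
    have "topspace M \<noteq> {}" using p by auto
    then show ?thesis
      by (rule smooth_function_attains_max[OF manifold assms(3) _ that]) blast
  qed
  obtain X f where X: "smooth_vector_field M A X" and f: "smooth_function A f"
    and grad: "is_gradient M A g X f" and pos: "positive_weighted_sec M A g X"
    using assms(5) by blast
  have "\<exists>q\<in>topspace M. \<forall>u v. orthonormal_pair A g q u v \<longrightarrow> sec A g q u v > 0"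
    using pos unfolding positive_weighted_sec_def
  proof (elim disjE exE conjE)
    assume P: "\<forall>p\<in>topspace M. \<forall>u v. orthonormal_pair A g p u v \<longrightarrow> sec_weighted A g X p v u > 0"
    obtain q where q: "q \<in> topspace M" "\<And>q'. q' \<in> topspace M \<Longrightarrow> f q' \<le> f q"
      using attains[OF f] by blast
    have "sec A g q u v > 0" if "orthonormal_pair A g q u v" for u v
    proof -
      have "sec_weighted A g X q v u > 0" using P q(1) that by blast
      then show ?thesis
        using lie_derivative_at_max[OF manifold metric f q X grad, of v] by (simp add: sec_weighted_def)
    qed
    then show ?thesis using q(1) by blast
  next
    fix f assume f: "smooth_function A f"
      and P: "\<forall>p\<in>topspace M. \<forall>u v. orthonormal_pair A g p u v \<longrightarrow> sec_bar A g f p v u > 0"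
    obtain q where q: "q \<in> topspace M" "\<And>q'. q' \<in> topspace M \<Longrightarrow> f q' \<le> f q"
      using attains[OF f] by blast
    have "sec A g q u v > 0" if "orthonormal_pair A g q u v" for u v
    proof -
      have "sec_bar A g f q v u > 0" using P q(1) that by blast
      then show ?thesis
        using hessian_at_max[OF manifold metric f q, of v] differential_at_max[OF manifold metric f q, of v]
        by (simp add: sec_bar_def)
    qed
    then show ?thesis using q(1) by blast
  qed
  then obtain q where q: "q \<in> topspace M"
    and sec: "\<And>u v. orthonormal_pair A g q u v \<Longrightarrow> sec A g q u v > 0" by blast
  \<comment> \<open>Moving \<open>p\<close> to \<open>q\<close> lets the given pair at
    \<open>p\<close> be pushed forward to where positivity is known.\<close>
  obtain F where F: "isometry M A g F" and Fp: "F p = q"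
    using assms(4) p q unfolding homogeneous_def by blast
  have u: "u \<in> tangent_space A p" and v: "v \<in> tangent_space A p"
    and on: "g p u u = 1" "g p v v = 1" "g p u v = 0"
    using uv by (auto simp: orthonormal_pair_def)
  have iso: "g (F p) (pushforward A F p u) (pushforward A F p v) = g p u v"
    if "u \<in> tangent_space A p" "v \<in> tangent_space A p" for u v
    using F p that by (simp add: isometry_def)
  have "pushforward A F p w \<in> tangent_space A (F p)" if "w \<in> tangent_space A p" for w
  proof -
    have c: "chart_at A p \<in> charts_at A p" "chart_at A (F p) \<in> charts_at A (F p)"
      using chart_at_in[OF manifold] p q Fp by auto
    have "smooth_map M A F" using F by (simp add: isometry_def)
    from pushforward_eq_tangent_of[OF manifold this p c that] show ?thesis
      using tangent_of_in[OF manifold c(2)] by simp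
  qed
  then have "orthonormal_pair A g q (pushforward A F p u) (pushforward A F p v)"
    using u v iso on Fp by (simp add: orthonormal_pair_def)
  from sec[OF this] show "sec A g p u v > 0"
    using sec_isometry[OF manifold metric F p u v] Fp by simp
qed

end
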